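(* Let $G$ be any graph and let $u,t$ be distinct vertices of $G$. The following are equivalent: (i) There exist infinitely many independent $u$–$t$ paths in $G$. (ii) There exists $v\in\mathcal U$ such that $u$ and $v$ have no disjoint open neighbourhoods in $\vartheta G$, and $t$ and $v$ have no disjoint open neighbourhoods in $\vartheta G$. (iii) There exists an end of $G$ dominated by both $u$ and $t$, or there exists an ultrafilter tangle $v\in\Upsilon$ with $\{u,t\}\subseteq X_v$. (iv) There exists an end of $G$ dominated by both $u$ and $t$, or there exists a critical $X\in\mathcal X$ containing both $u$ and $t$.
   Context: $G$ is regarded as a 1-complex: edges are copies of $[0,1]$; inner edge points have their usual neighbourhoods, and a basic open neighbourhood of a vertex $w$ is a union of half-open intervals $[w,j_e)$, one for each edge $e$ at $w$, with $j_e$ an arbitrary inner point of $e$. Let $\mathcal X$ be the set of finite subsets of $V(G)$; $\mathcal C_X$ the set of components of $G-X$; for $X\subseteq X'$, $\phi_{X',X}:\mathcal C_{X'}\to\mathcal C_X$ sends a component to the component of $G-X$ containing it. $\mathcal U_X$ is the set of ultrafilters on $\mathcal C_X$, $f_{X',X}(U')=\{\mathcal C\subseteq\mathcal C_X:\exists\mathcal C'\in U',\ \mathcal C\supseteq\phi_{X',X}[\mathcal C']\}$, and $\mathcal U$ is the set of families $(U_X)_{X\in\mathcal X}$ with $U_X\in\mathcal U_X$ and $f_{X',X}(U_{X'})=U_X$ for $X\subseteq X'$. The tangle compactification $\vartheta G=G\cup\mathcal U$ has the topology generated by the open sets of the 1-complex $G$ and, for $X\in\mathcal X$, $\mathcal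 C\subseteq\mathcal C_X$, the sets $\bigcup\mathcal C\cup\mathring E(X,\bigcup\mathcal C)\cup\{(U_Y)_Y\in\mathcal U:\mathcal C\in U_X\}$ ($\bigcup\mathcal C$ the 1-complex of the union of the components in $\mathcal C$, $\mathring E(X,\bigcup\mathcal C)$ the inner points of edges between $X$ and $\bigcup\mathcal C$). $\Upsilon$ is the set of $v=(U_X)\in\mathcal U$ having some non-principal $U_X$; for $v\in\Upsilon$, $X_v$ is the unique least $X\in\mathcal X$ with $U_X$ non-principal. An end of $G$ is an equivalence class of rays, two rays being equivalent if no finite vertex set separates them. A vertex $w$ dominates an end $\omega$ if no finite subset of $V(G)\setminus\{w\}$ separates $w$ from a ray in $\omega$. A set $X\in\mathcal X$ is critical if infinitely many components of $G-X$ have neighbourhood exactly $X$. *)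

theory Defs
  imports "HOL-Analysis.Abstract_Topology" "HOL-Library.FuncSet"
begin

definition simple_graph :: "'a set \<Rightarrow> 'a set set \<Rightarrow> bool" where
  "simple_graph V E \<longleftrightarrow> (\<forall>e\<in>E. e \<subseteq> V \<and> card e = 2)"

text \<open>Paths are nonempty lists of distinct vertices; one-vertex paths are allowed.\<close>

definition is_path :: "'a set \<Rightarrow> 'a set set \<Rightarrow> 'a list \<Rightarrow> bool" where
  "is_path V E p \<longleftrightarrow>
     p \<noteq> [] \<and> distinct p \<and> set p \<subseteq> V \<and> successively (\<lambda>x y. {x, y} \<in> E) p"

definition AB_path :: "'a set \<Rightarrow> 'a set set \<Rightarrow> 'a set \<Rightarrow> 'a set \<Rightarrow> 'a list \<Rightarrow> bool" where
  "AB_path V E A B p \<longleftrightarrow>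
     is_path V E p \<and> set p \<inter> A = {hd p} \<and> set p \<inter> B = {last p}"

definition inner_vertices :: "'a list \<Rightarrow> 'a set" where
  "inner_vertices p = set p - {hd p, last p}"

definition independent_paths :: "'a list set \<Rightarrow> bool" where
  "independent_paths P \<longleftrightarrow> (\<forall>p\<in>P. \<forall>q\<in>P. p \<noteq> q \<longrightarrow> inner_vertices p \<inter> set q = {})"

definition separates :: "'a set \<Rightarrow> 'a set set \<Rightarrow> 'a set \<Rightarrow> 'a set \<Rightarrow> 'a set \<Rightarrow> bool" where
  "separates V E S A B \<longleftrightarrow> (\<forall>p. AB_path V E A B p \<longrightarrow> set p \<inter> S \<noteq> {})"

definition finite_vertex_sets :: "'a set \<Rightarrow> 'a set set" where
  "finite_vertex_sets V = {X. finite X \<and> X \<subseteq> V}"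

text \<open>A ray is given by its sequence of vertices, starting with the one of degree 1.\<close>

definition rays :: "'a set \<Rightarrow> 'a set set \<Rightarrow> (nat \<Rightarrow> 'a) set" where
  "rays V E = {r. inj r \<and> range r \<subseteq> V \<and> (\<forall>n. {r n, r (Suc n)} \<in> E)}"

definition ray_equiv :: "'a set \<Rightarrow> 'a set set \<Rightarrow> ((nat \<Rightarrow> 'a) \<times> (nat \<Rightarrow> 'a)) set" where
  "ray_equiv V E = {(r, s). r \<in> rays V E \<and> s \<in> rays V E \<and>
     \<not> (\<exists>S \<in> finite_vertex_sets V. separates V E S (range r) (range s))}"

definition graph_ends :: "'a set \<Rightarrow> 'a set set \<Rightarrow> (nat \<Rightarrow> 'a) set set" where
  "graph_ends V E = rays V E // ray_equiv V E"

text \<open>The quantification is over all rays of the end. It would be wrong to ask this of a single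
  ray only, since a vertex on a ray is not separated from that ray by any set avoiding the vertex.\<close>

definition dominates :: "'a set \<Rightarrow> 'a set set \<Rightarrow> 'a \<Rightarrow> (nat \<Rightarrow> 'a) set \<Rightarrow> bool" where
  "dominates V E w \<omega> \<longleftrightarrow>
     \<not> (\<exists>S \<in> finite_vertex_sets (V - {w}). \<exists>r\<in>\<omega>. separates V E S {w} (range r))"

definition connected_set :: "'a set \<Rightarrow> 'a set set \<Rightarrow> 'a set \<Rightarrow> bool" where
  "connected_set V E C \<longleftrightarrow> C \<noteq> {} \<and> C \<subseteq> V \<and>
     (\<forall>x\<in>C. \<forall>y\<in>C. \<exists>p. is_path V E p \<and> set p \<subseteq> C \<and> hd p = x \<and> last p = y)"

text \<open>Components of \<open>G - X\<close> are maximal connected subgraphs of \<open>G - X\<close>. They are induced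
  subgraphs, hence represented by their vertex sets.\<close>

definition graph_comps :: "'a set \<Rightarrow> 'a set set \<Rightarrow> 'a set \<Rightarrow> 'a set set" where
  "graph_comps V E X = {C. C \<subseteq> V - X \<and> connected_set V E C \<and>
     (\<forall>D. D \<subseteq> V - X \<and> connected_set V E D \<and> C \<subseteq> D \<longrightarrow> D = C)}"

definition neighbourhood :: "'a set \<Rightarrow> 'a set set \<Rightarrow> 'a set \<Rightarrow> 'a set" where
  "neighbourhood V E C = {y \<in> V - C. \<exists>x\<in>C. {x, y} \<in> E}"

definition critical :: "'a set \<Rightarrow> 'a set set \<Rightarrow> 'a set \<Rightarrow> bool" where
  "critical V E X \<longleftrightarrow> X \<in> finite_vertex_sets V \<and>
     infinite {C \<in> graph_comps V E X. neighbourhood V E C = X}"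

definition ultrafilters_on :: "'b set \<Rightarrow> 'b set set set" where
  "ultrafilters_on S = {U. U \<subseteq> Pow S \<and> S \<in> U \<and> {} \<notin> U \<and>
     (\<forall>A\<in>U. \<forall>B. A \<subseteq> B \<and> B \<subseteq> S \<longrightarrow> B \<in> U) \<and>
     (\<forall>A\<in>U. \<forall>B\<in>U. A \<inter> B \<in> U) \<and>
     (\<forall>A. A \<subseteq> S \<longrightarrow> A \<in> U \<or> S - A \<in> U)}"

definition principal_on :: "'b set \<Rightarrow> 'b set set \<Rightarrow> bool" where
  "principal_on S U \<longleftrightarrow> (\<exists>c\<in>S. U = {A. A \<subseteq> S \<and> c \<in> A})"

text \<open>In \<open>comp_map V E X' X\<close> and \<open>uf_map V E X' X\<close> it is understood that \<open>X \<subseteq> X'\<close>.\<close>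

definition comp_map :: "'a set \<Rightarrow> 'a set set \<Rightarrow> 'a set \<Rightarrow> 'a set \<Rightarrow> 'a set \<Rightarrow> 'a set" where
  "comp_map V E X' X C' = (THE C. C \<in> graph_comps V E X \<and> C' \<subseteq> C)"

definition uf_map :: "'a set \<Rightarrow> 'a set set \<Rightarrow> 'a set \<Rightarrow> 'a set \<Rightarrow> 'a set set set \<Rightarrow> 'a set set set" where
  "uf_map V E X' X U' =
     {\<C>. \<C> \<subseteq> graph_comps V E X \<and> (\<exists>\<C>'\<in>U'. comp_map V E X' X ` \<C>' \<subseteq> \<C>)}"

type_synonym 'a uf_family = "'a set \<Rightarrow> 'a set set set"

definition uf_limit :: "'a set \<Rightarrow> 'a set set \<Rightarrow> 'a uf_family set" where
  "uf_limit V E =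
     {v \<in> (\<Pi>\<^sub>E X\<in>finite_vertex_sets V. ultrafilters_on (graph_comps V E X)).
        \<forall>X\<in>finite_vertex_sets V. \<forall>X'\<in>finite_vertex_sets V.
          X \<subseteq> X' \<longrightarrow> uf_map V E X' X (v X') = v X}"

definition uf_tangles :: "'a set \<Rightarrow> 'a set set \<Rightarrow> 'a uf_family set" where
  "uf_tangles V E = {v \<in> uf_limit V E.
     \<exists>X\<in>finite_vertex_sets V. \<not> principal_on (graph_comps V E X) (v X)}"

definition least_nonprincipal :: "'a set \<Rightarrow> 'a set set \<Rightarrow> 'a uf_family \<Rightarrow> 'a set" where
  "least_nonprincipal V E v =
     (LEAST X. X \<in> finite_vertex_sets V \<and> \<not> principal_on (graph_comps V E X) (v X))"

text \<open>Points of the tangle compactification. The edge \<open>e\<close> is identified with \<open>[0, 1]\<close> so that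
  \<open>0\<close> corresponds to the endvertex \<open>edge_tail e\<close>; its inner points are \<open>Inner e s\<close> with
  \<open>0 < s < 1\<close>.\<close>

datatype 'a tpoint = Vertex 'a | Inner "'a set" real | Tangle "'a uf_family"

definition edge_tail :: "'a set \<Rightarrow> 'a" where
  "edge_tail e = (SOME x. x \<in> e)"

definition dist_from :: "'a \<Rightarrow> 'a set \<Rightarrow> real \<Rightarrow> real" where
  "dist_from w e s = (if w = edge_tail e then s else 1 - s)"

definition inner_points :: "'a set \<Rightarrow> 'a tpoint set" where
  "inner_points e = {Inner e s |s. 0 < s \<and> s < 1}"

text \<open>The inner points \<open>j\<^sub>e\<close> are given by their distances \<open>j e\<close> from \<open>w\<close> along \<open>e\<close>.\<close>

definition vertex_star :: "'a set set \<Rightarrow> 'a \<Rightarrow> ('a set \<Rightarrow> real) \<Rightarrow> 'a tpoint set" where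
  "vertex_star E w j = insert (Vertex w)
     {Inner e s |e s. e \<in> E \<and> w \<in> e \<and> 0 < s \<and> s < 1 \<and> dist_from w e s < j e}"

definition complex_topology :: "'a set \<Rightarrow> 'a set set \<Rightarrow> 'a tpoint topology" where
  "complex_topology V E = topology_generated_by
     ({{Inner e s |s. a < s \<and> s < b} |e a b. e \<in> E \<and> 0 \<le> a \<and> a < b \<and> b \<le> 1} \<union>
      {vertex_star E w j |w j. w \<in> V \<and> (\<forall>e\<in>E. w \<in> e \<longrightarrow> 0 < j e \<and> j e < 1)})"

definition comps_complex :: "'a set set \<Rightarrow> 'a set set \<Rightarrow> 'a tpoint set" where
  "comps_complex E \<C> = Vertex ` \<Union>\<C> \<union> \<Union>{inner_points e |e. e \<in> E \<and> (\<exists>C\<in>\<C>. e \<subseteq> C)}"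

definition between_points :: "'a set set \<Rightarrow> 'a set \<Rightarrow> 'a set \<Rightarrow> 'a tpoint set" where
  "between_points E A B = \<Union>{inner_points e |e. e \<in> E \<and> (\<exists>x\<in>A. \<exists>y\<in>B. e = {x, y})}"

definition basic_tangle_set ::
    "'a set \<Rightarrow> 'a set set \<Rightarrow> 'a set \<Rightarrow> 'a set set \<Rightarrow> 'a tpoint set" where
  "basic_tangle_set V E X \<C> =
     comps_complex E \<C> \<union> between_points E X (\<Union>\<C>) \<union> Tangle ` {v \<in> uf_limit V E. \<C> \<in> v X}"

definition tangle_topology :: "'a set \<Rightarrow> 'a set set \<Rightarrow> 'a tpoint topology" where
  "tangle_topology V E = topology_generated_by
     ({A. openin (complex_topology V E) A} \<union>
      {basic_tangle_set V E X \<C> |X \<C>. X \<in> finite_vertex_sets V \<and> \<C> \<subseteq> graph_comps V E X})"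

definition have_disjoint_open_nbhds :: "'b topology \<Rightarrow> 'b \<Rightarrow> 'b \<Rightarrow> bool" where
  "have_disjoint_open_nbhds T x y \<longleftrightarrow>
     (\<exists>A B. openin T A \<and> openin T B \<and> x \<in> A \<and> y \<in> B \<and> disjnt A B)"

end

theory Submission
  imports Defs
begin

text \<open>
  The conditions are proved in a cycle, from (i) to (iv) and back.

  The interiors of infinitely many independent \<open>u\<close>--\<open>t\<close> paths form an infinite family of disjoint
  connected sets; a free ultrafilter on this family induces an element of \<open>\<U>\<close> that cannot be
  separated from \<open>u\<close> or \<open>t\<close>.

  Let \<open>v\<close> be inseparable from \<open>u\<close> and \<open>t\<close>. If some \<open>U\<^sub>X\<close> is non-principal, then \<open>u\<close> and \<open>t\<close> lie
  in \<open>X\<^sub>v\<close>, since otherwise two complementary basic open sets at \<open>X\<^sub>v\<close> would separate. If all \<open>U\<^sub>X\<close>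
  are principal, they choose one component \<open>C(X)\<close> of each \<open>G - X\<close>, and both \<open>u\<close> and \<open>t\<close> have
  neighbours in \<open>C(X)\<close> whenever they lie in \<open>X\<close>. This lets one build a ray through disjoint finite
  connected blocks, each of which contains neighbours of both vertices.

  The set \<open>X\<^sub>v\<close> is critical: it is the common neighbourhood of \<open>U\<^sub>X\<close>-almost all components
  of \<open>G - X\<close>, for any non-principal \<open>U\<^sub>X\<close>. Finally, both a dominated end and a critical set provide,
  outside any finite set, a connected set adjacent to \<open>u\<close> and to \<open>t\<close>, so that independent paths
  can be chosen greedily.
\<close>

section \<open>Existence of ultrafilters below a proper filter\<close>

text \<open>Zorn's lemma for the reversed order on proper filters: the infimum of a nonempty chain
  stays proper, because whatever holds eventually in it already does so in some member. A minimal
  proper filter decides every \<open>P\<close>, since restricting it to \<open>P\<close> gives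
  either \<open>bot\<close> or the same filter.\<close>

lemma exists_ultrafilter_le:
  fixes F :: "'b filter"
  assumes "F \<noteq> bot"
  obtains U where "U \<noteq> bot" "U \<le> F" "\<And>P. eventually P U \<or> eventually (\<lambda>x. \<not> P x) U"
proof -
  let ?A = "{G. G \<noteq> bot \<and> G \<le> F}"
  have "\<exists>m\<in>?A. \<forall>a\<in>?A. m \<ge> a \<longrightarrow> a = m"
  proof (rule predicate_Zorn)
    show "partial_order_on ?A (relation_of (\<ge>) ?A)"
      by (rule partial_order_on_relation_ofI) auto
  next
    fix C assume C: "C \<in> Chains (relation_of (\<ge>) ?A)"
    show "\<exists>u\<in>?A. \<forall>a\<in>C. a \<ge> u"
    proof (cases "C = {}")
      case True
      then show ?thesis using assms by auto
    next
      case False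
      have sub: "C \<subseteq> ?A" using C by (auto simp: Chains_def relation_of_def)
      have lin: "G \<le> H \<or> H \<le> G" if "G \<in> C" "H \<in> C" for G H
        using C that by (auto simp: Chains_def relation_of_def)
      have "eventually P (Inf C) \<longleftrightarrow> (\<exists>b\<in>C. eventually P b)" for P
      proof (rule eventually_Inf_base[OF False])
        fix G H assume "G \<in> C" "H \<in> C"
        then show "\<exists>x\<in>C. x \<le> inf G H" using lin[of G H] by auto
      qed
      then have "Inf C \<noteq> bot" using sub by (auto simp: trivial_limit_def)
      moreover have "Inf C \<le> F" using False sub by (auto intro: Inf_lower2)
      ultimately show ?thesis by (auto intro: Inf_lower)
    qed
  qed
  then obtain U where U: "U \<noteq> bot" "U \<le> F" and min: "\<And>G. G \<noteq> bot \<Longrightarrow> G \<le> U \<Longrightarrow> G = U"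
    by auto
  have "eventually P U \<or> eventually (\<lambda>x. \<not> P x) U" for P
  proof (cases "inf U (principal {x. P x}) = bot")
    case True
    then show ?thesis by (auto simp: trivial_limit_def eventually_inf_principal)
  next
    case False
    then have eq: "inf U (principal {x. P x}) = U" by (intro min) auto
    have "eventually P (inf U (principal {x. P x}))" by (simp add: eventually_inf_principal)
    then show ?thesis unfolding eq by simp
  qed
  with U that show ?thesis by blast
qed

section \<open>Connected sets and components\<close>

text \<open>Adjacency within \<open>C\<close> as a relation, so that connectedness becomes
  reachability in its reflexive transitive closure, where concatenation needs no care about repeated
  vertices.\<close>

definition edge_rel :: "'a set set \<Rightarrow> 'a set \<Rightarrow> ('a \<times> 'a) set" where
  "edge_rel E C = {(x, y). x \<in> C \<and> y \<in> C \<and> {x, y} \<in> E}"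

lemma edge_rel_mono: "C \<subseteq> D \<Longrightarrow> edge_rel E C \<subseteq> edge_rel E D"
  by (auto simp: edge_rel_def)

lemma edge_rel_rtrancl_mono:
  "(x, y) \<in> (edge_rel E C)\<^sup>* \<Longrightarrow> C \<subseteq> D \<Longrightarrow> (x, y) \<in> (edge_rel E D)\<^sup>*"
  using rtrancl_mono[OF edge_rel_mono] by blast

lemma edge_rel_rtrancl_sym: "(x, y) \<in> (edge_rel E C)\<^sup>* \<Longrightarrow> (y, x) \<in> (edge_rel E C)\<^sup>*"
proof -
  have "sym (edge_rel E C)" by (auto simp: sym_def edge_rel_def insert_commute)
  then show "(x, y) \<in> (edge_rel E C)\<^sup>* \<Longrightarrow> (y, x) \<in> (edge_rel E C)\<^sup>*"
    by (meson sym_rtrancl symD)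
qed

lemma successively_imp_rtrancl:
  "successively (\<lambda>x y. {x, y} \<in> E) p \<Longrightarrow> p \<noteq> [] \<Longrightarrow> set p \<subseteq> C \<Longrightarrow> y \<in> set p \<Longrightarrow>
    (hd p, y) \<in> (edge_rel E C)\<^sup>*"
proof (induction p)
  case (Cons a p)
  show ?case
  proof (cases "y = a")
    case False
    then have y: "y \<in> set p" "p \<noteq> []" using Cons.prems by auto
    then have "(hd p, y) \<in> (edge_rel E C)\<^sup>*" using Cons by (auto simp: successively_Cons)
    moreover have "(a, hd p) \<in> edge_rel E C"
      using Cons.prems y by (auto simp: successively_Cons edge_rel_def)
    ultimately show ?thesis by (simp add: converse_rtrancl_into_rtrancl)
  qed simp
qed simp

text \<open>The path grows along the walk; if the next vertex already lies on it, the path is cut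
  there, which keeps its vertices distinct.\<close>

lemma rtrancl_imp_path:
  assumes "(x, y) \<in> (edge_rel E C)\<^sup>*" "x \<in> C" "C \<subseteq> V"
  shows "\<exists>p. is_path V E p \<and> set p \<subseteq> C \<and> hd p = x \<and> last p = y"
  using assms(1)
proof (induction rule: rtrancl_induct)
  case base
  show ?case using assms by (intro exI[of _ "[x]"]) (auto simp: is_path_def)
next
  case (step y z)
  then obtain p where p: "is_path V E p" "set p \<subseteq> C" "hd p = x" "last p = y" by blast
  have yz: "z \<in> C" "{y, z} \<in> E" using step by (auto simp: edge_rel_def)
  show ?case
  proof (cases "z \<in> set p")
    case True
    then obtain as bs where s: "p = as @ z # bs" by (meson split_list)
    have "is_path V E (as @ [z])"
      using p(1) unfolding s is_path_def by (auto simp: successively_append_iff)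
    moreover have "hd (as @ [z]) = x" using p(3) s by (cases as) auto
    ultimately show ?thesis using p(2) s by (intro exI[of _ "as @ [z]"]) auto
  next
    case False
    have "is_path V E (p @ [z])"
      using p yz False assms(3) unfolding is_path_def by (auto simp: successively_append_iff)
    moreover have "hd (p @ [z]) = x" using p by (auto simp: is_path_def)
    ultimately show ?thesis using p yz by (intro exI[of _ "p @ [z]"]) auto
  qed
qed

lemma connected_set_iff:
  "connected_set V E C \<longleftrightarrow>
     C \<noteq> {} \<and> C \<subseteq> V \<and> (\<forall>x\<in>C. \<forall>y\<in>C. (x, y) \<in> (edge_rel E C)\<^sup>*)"
proof -
  have "(\<exists>p. is_path V E p \<and> set p \<subseteq> C \<and> hd p = x \<and> last p = y)
      \<longleftrightarrow> (x, y) \<in> (edge_rel E C)\<^sup>*" if "x \<in> C" "C \<subseteq> V" for x y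
  proof
    assume "\<exists>p. is_path V E p \<and> set p \<subseteq> C \<and> hd p = x \<and> last p = y"
    then obtain p where "is_path V E p" "set p \<subseteq> C" "hd p = x" "last p = y" by blast
    then show "(x, y) \<in> (edge_rel E C)\<^sup>*"
      using successively_imp_rtrancl[of E p C y] by (auto simp: is_path_def)
  qed (use rtrancl_imp_path that in metis)
  then show ?thesis unfolding connected_set_def by blast
qed

lemma connected_set_path:
  assumes "connected_set V E C" "x \<in> C" "y \<in> C"
  obtains p where "is_path V E p" "set p \<subseteq> C" "hd p = x" "last p = y"
  using assms unfolding connected_set_def by blast

lemma is_path_connected:
  assumes "is_path V E p"
  shows "connected_set V E (set p)"
proof -
  have "(hd p, y) \<in> (edge_rel E (set p))\<^sup>*" if "y \<in> set p" for y
    using successively_imp_rtrancl[of E p "set p" y] assms that by (auto simp: is_path_def)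
  then have "(x, y) \<in> (edge_rel E (set p))\<^sup>*" if "x \<in> set p" "y \<in> set p" for x y
    using that by (meson edge_rel_rtrancl_sym rtrancl_trans)
  then show ?thesis using assms unfolding connected_set_iff is_path_def by auto
qed

lemma connected_singleton: "x \<in> V \<Longrightarrow> connected_set V E {x}"
  by (simp add: connected_set_iff)

lemma connected_Union:
  assumes "\<D> \<noteq> {}" "\<And>D. D \<in> \<D> \<Longrightarrow> connected_set V E D \<and> x \<in> D"
  shows "connected_set V E (\<Union>\<D>)"
proof -
  have "(x, y) \<in> (edge_rel E (\<Union>\<D>))\<^sup>*" if "y \<in> \<Union>\<D>" for y
    using that assms(2) edge_rel_rtrancl_mono[of x y E _ "\<Union>\<D>"]
    unfolding connected_set_iff by blast
  then have "(z, y) \<in> (edge_rel E (\<Union>\<D>))\<^sup>*" if "y \<in> \<Union>\<D>" "z \<in> \<Union>\<D>" for y z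
    using that by (meson edge_rel_rtrancl_sym rtrancl_trans)
  then show ?thesis using assms unfolding connected_set_iff by blast
qed

lemma connected_Un:
  assumes "connected_set V E A" "connected_set V E B" "A \<inter> B \<noteq> {}"
  shows "connected_set V E (A \<union> B)"
proof -
  obtain x where "x \<in> A" "x \<in> B" using assms by blast
  then show ?thesis using connected_Union[of "{A, B}" V E x] assms by auto
qed

lemma connected_Un_edge:
  assumes "connected_set V E A" "connected_set V E B" "a \<in> A" "b \<in> B" "{a, b} \<in> E"
  shows "connected_set V E (A \<union> B)"
proof -
  have V: "a \<in> V" "b \<in> V" using assms unfolding connected_set_def by auto
  have ab: "connected_set V E {a, b}"
    using V assms(5) by (auto simp: connected_set_iff edge_rel_def insert_commute)
  have "connected_set V E (A \<union> {a, b})" by (rule connected_Un) (use assms ab in auto)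
  then have "connected_set V E (A \<union> {a, b} \<union> B)" by (rule connected_Un) (use assms in auto)
  then show ?thesis using assms by (simp add: insert_absorb)
qed

text \<open>A shortest path within \<open>D\<close> from \<open>A\<close> to \<open>B\<close> meets
  \<open>A\<close> only at its start and \<open>B\<close> only at its end, as otherwise a proper
  suffix or prefix would be shorter. Later arguments can therefore glue connected sets instead of
  handling paths.\<close>

lemma not_separates_iff:
  "\<not> separates V E S A B \<longleftrightarrow>
     (\<exists>D. connected_set V E D \<and> D \<inter> S = {} \<and> D \<inter> A \<noteq> {} \<and> D \<inter> B \<noteq> {})"
proof
  assume "\<not> separates V E S A B"
  then obtain p where "AB_path V E A B p" "set p \<inter> S = {}" unfolding separates_def by blast
  then show "\<exists>D. connected_set V E D \<and> D \<inter> S = {} \<and> D \<inter> A \<noteq> {} \<and> D \<inter> B \<noteq> {}"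
    using is_path_connected[of V E p] unfolding AB_path_def by blast
next
  assume "\<exists>D. connected_set V E D \<and> D \<inter> S = {} \<and> D \<inter> A \<noteq> {} \<and> D \<inter> B \<noteq> {}"
  then obtain D a b where D: "connected_set V E D" "D \<inter> S = {}" "a \<in> D" "a \<in> A" "b \<in> D" "b \<in> B"
    by blast
  define Q where "Q p \<longleftrightarrow> is_path V E p \<and> set p \<subseteq> D \<and> hd p \<in> A \<and> last p \<in> B" for p
  obtain p0 where "Q p0" using connected_set_path[OF D(1,3,5)] D(4,6) unfolding Q_def by metis
  then obtain p where p: "Q p" and min: "\<And>q. Q q \<Longrightarrow> length p \<le> length q"
    using arg_min_natI[of Q p0 length] arg_min_nat_le[of Q _ length] by metis
  have "x = hd p" if "x \<in> set p" "x \<in> A" for x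
  proof -
    obtain as bs where s: "p = as @ x # bs" using \<open>x \<in> set p\<close> by (meson split_list)
    have "Q (x # bs)" using p that unfolding s Q_def is_path_def
      by (auto simp: successively_append_iff)
    then show ?thesis using min[of "x # bs"] s by auto
  qed
  moreover have "x = last p" if "x \<in> set p" "x \<in> B" for x
  proof -
    obtain as bs where s: "p = as @ x # bs" using \<open>x \<in> set p\<close> by (meson split_list)
    have "hd (as @ [x]) = hd p" using s by (cases as) auto
    then have "Q (as @ [x])" using p that unfolding s Q_def is_path_def
      by (auto simp: successively_append_iff)
    then show ?thesis using min[of "as @ [x]"] s by auto
  qed
  ultimately have "AB_path V E A B p"
    using p unfolding Q_def AB_path_def is_path_def by fastforce
  moreover have "set p \<inter> S = {}" using p D unfolding Q_def by blast
  ultimately show "\<not> separates V E S A B" unfolding separates_def by blast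
qed

section \<open>Components of the graph minus a vertex set\<close>

lemma comp_connected: "C \<in> graph_comps V E X \<Longrightarrow> connected_set V E C"
  and comp_subset: "C \<in> graph_comps V E X \<Longrightarrow> C \<subseteq> V - X"
  and comp_nonempty: "C \<in> graph_comps V E X \<Longrightarrow> C \<noteq> {}"
  by (auto simp: graph_comps_def connected_set_def)

lemma comp_maximal:
  "C \<in> graph_comps V E X \<Longrightarrow> connected_set V E D \<Longrightarrow> D \<subseteq> V - X \<Longrightarrow> C \<subseteq> D \<Longrightarrow> D = C"
  by (auto simp: graph_comps_def)

lemma comp_absorb:
  assumes "C \<in> graph_comps V E X" "connected_set V E D" "D \<inter> X = {}" "D \<inter> C \<noteq> {}"
  shows "D \<subseteq> C"
proof -
  have "connected_set V E (C \<union> D)"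
    by (rule connected_Un) (use assms comp_connected[OF assms(1)] in auto)
  moreover have "C \<union> D \<subseteq> V - X"
    using assms comp_subset[OF assms(1)] unfolding connected_set_def by blast
  ultimately show ?thesis using comp_maximal[OF assms(1)] by blast
qed

lemma comp_unique:
  "C \<in> graph_comps V E X \<Longrightarrow> D \<in> graph_comps V E X \<Longrightarrow> C \<inter> D \<noteq> {} \<Longrightarrow> C = D"
  using comp_absorb[of C V E X D] comp_absorb[of D V E X C] comp_connected[of _ V E X]
    comp_subset[of C V E X] comp_subset[of D V E X] by blast

lemma comp_exists:
  assumes "connected_set V E D" "D \<inter> X = {}"
  obtains C where "C \<in> graph_comps V E X" "D \<subseteq> C"
proof -
  obtain x where x: "x \<in> D" using assms unfolding connected_set_def by blast
  define \<D> where "\<D> = {D. connected_set V E D \<and> D \<subseteq> V - X \<and> x \<in> D}"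
  have D: "D \<in> \<D>" using assms x unfolding \<D>_def connected_set_def by blast
  have "connected_set V E (\<Union>\<D>)"
    by (rule connected_Union[of _ _ _ x]) (use D in \<open>auto simp: \<D>_def\<close>)
  moreover have "\<Union>\<D> \<subseteq> V - X" unfolding \<D>_def by blast
  moreover have "D' = \<Union>\<D>" if "D' \<subseteq> V - X" "connected_set V E D'" "\<Union>\<D> \<subseteq> D'" for D'
  proof -
    have "D' \<in> \<D>" using that x D unfolding \<D>_def by blast
    then show ?thesis using that by blast
  qed
  ultimately have "\<Union>\<D> \<in> graph_comps V E X" unfolding graph_comps_def by blast
  then show ?thesis using that D by blast
qed

lemma comp_of_vertex:
  assumes "x \<in> V" "x \<notin> X"
  obtains C where "C \<in> graph_comps V E X" "x \<in> C"
  using comp_exists[of V E "{x}" X] connected_singleton[of x V E] assms by auto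

lemma Union_comps: "\<Union>(graph_comps V E X) = V - X"
  using comp_subset[of _ V E X] by (fastforce elim: comp_of_vertex[of _ V X E])

lemma comp_edge:
  assumes "simple_graph V E" "C \<in> graph_comps V E X" "x \<in> C" "{x, y} \<in> E" "y \<notin> X"
  shows "y \<in> C"
proof -
  have "y \<in> V" using assms unfolding simple_graph_def by blast
  then have "connected_set V E (C \<union> {y})"
    using connected_Un_edge[of V E C "{y}" x y] assms comp_connected[OF assms(2)]
      connected_singleton[of y V E] by blast
  then show ?thesis
    using comp_maximal[OF assms(2), of "C \<union> {y}"] comp_subset[OF assms(2)] assms \<open>y \<in> V\<close> by blast
qed

lemma comp_antimono:
  assumes "X \<subseteq> Y" "C \<in> graph_comps V E Y"
  obtains D where "D \<in> graph_comps V E X" "C \<subseteq> D"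
  using comp_exists[of V E C X] comp_connected[OF assms(2)] comp_subset[OF assms(2)] assms(1)
  by blast

lemma comp_neighbourhood_subset:
  assumes "simple_graph V E" "C \<in> graph_comps V E X"
  shows "neighbourhood V E C \<subseteq> X"
  using comp_edge[OF assms] unfolding neighbourhood_def by blast

text \<open>A walk inside the component around \<open>C\<close> cannot leave \<open>C\<close>
  without entering \<open>X\<close>. This serves to recognise a component left by a larger deleted
  set as one left by a smaller set.\<close>

lemma connected_neighbourhood_comp:
  assumes "simple_graph V E" "connected_set V E C" "neighbourhood V E C \<subseteq> X" "C \<inter> X = {}"
  shows "C \<in> graph_comps V E X"
proof -
  obtain D where D: "D \<in> graph_comps V E X" "C \<subseteq> D" using comp_exists assms(2,4) by metis
  obtain x where x: "x \<in> C" using assms unfolding connected_set_def by blast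
  have "y \<in> C" if "y \<in> D" for y
  proof -
    have "(x, y) \<in> (edge_rel E D)\<^sup>*"
      using comp_connected[OF D(1)] D x that unfolding connected_set_iff by blast
    then show ?thesis
    proof (induction rule: rtrancl_induct)
      case (step y z)
      then show ?case using comp_subset[OF D(1)] assms(3)
        unfolding edge_rel_def neighbourhood_def by blast
    qed (use x in simp)
  qed
  then show ?thesis using D by (metis subsetI subset_antisym)
qed

section \<open>Ultrafilter tangles\<close>

lemma ultrafilter_superset:
  "U \<in> ultrafilters_on S \<Longrightarrow> A \<in> U \<Longrightarrow> A \<subseteq> B \<Longrightarrow> B \<subseteq> S \<Longrightarrow> B \<in> U"
  unfolding ultrafilters_on_def by blast

lemma ultrafilter_Int: "U \<in> ultrafilters_on S \<Longrightarrow> A \<in> U \<Longrightarrow> B \<in> U \<Longrightarrow> A \<inter> B \<in> U"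
  unfolding ultrafilters_on_def by blast

lemma ultrafilter_compl: "U \<in> ultrafilters_on S \<Longrightarrow> A \<subseteq> S \<Longrightarrow> A \<notin> U \<Longrightarrow> S - A \<in> U"
  unfolding ultrafilters_on_def by blast

lemma ultrafilter_empty: "U \<in> ultrafilters_on S \<Longrightarrow> {} \<notin> U"
  unfolding ultrafilters_on_def by blast

lemma ultrafilter_nonempty: "U \<in> ultrafilters_on S \<Longrightarrow> S \<in> U"
  unfolding ultrafilters_on_def by blast

lemma ultrafilter_sub: "U \<in> ultrafilters_on S \<Longrightarrow> A \<in> U \<Longrightarrow> A \<subseteq> S"
  unfolding ultrafilters_on_def by blast

text \<open>If \<open>A j\<close> is not in \<open>U\<close>, intersecting the union with the
  complement of \<open>A j\<close> leaves a set covered by the remaining \<open>A i\<close>.\<close>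

lemma ultrafilter_finite_UN:
  assumes U: "U \<in> ultrafilters_on S" and "finite I"
    and "(\<Union>i\<in>I. A i) \<in> U" "\<And>i. i \<in> I \<Longrightarrow> A i \<subseteq> S"
  shows "\<exists>i\<in>I. A i \<in> U"
  using assms(2-)
proof (induction I)
  case empty
  then show ?case using U by (simp add: ultrafilters_on_def)
next
  case (insert j I)
  show ?case
  proof (cases "A j \<in> U")
    case False
    then have "S - A j \<in> U" using ultrafilter_compl[OF U, of "A j"] insert.prems by blast
    then have "(S - A j) \<inter> (\<Union>i\<in>insert j I. A i) \<in> U"
      using ultrafilter_Int[OF U] insert.prems(1) by blast
    then have "(\<Union>i\<in>I. A i) \<in> U"
      by (rule ultrafilter_superset[OF U]) (use insert.prems(2) in auto)
    then show ?thesis using insert.IH insert.prems(2) by blast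
  qed auto
qed

text \<open>Splitting \<open>A\<close> into singletons gives a generator. The use is contrapositive:
  a non-principal ultrafilter contains no finite set.\<close>

lemma ultrafilter_finite_principal:
  assumes U: "U \<in> ultrafilters_on S" and "finite A" "A \<in> U"
  shows "principal_on S U"
proof -
  have sub: "A \<subseteq> S" using assms by (auto simp: ultrafilters_on_def)
  have "\<exists>c\<in>A. {c} \<in> U"
    by (rule ultrafilter_finite_UN[OF U assms(2)]) (use assms sub in auto)
  then obtain c where c: "c \<in> S" "{c} \<in> U" using sub by blast
  have "B \<in> U \<longleftrightarrow> B \<subseteq> S \<and> c \<in> B" for B
  proof
    assume "B \<in> U"
    then have "{c} \<inter> B \<in> U" "B \<subseteq> S" using U c by (auto simp: ultrafilters_on_def)
    then show "B \<subseteq> S \<and> c \<in> B" using U by (cases "c \<in> B") (auto simp: ultrafilters_on_def)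
  next
    assume "B \<subseteq> S \<and> c \<in> B"
    then have "{c} \<subseteq> B" "B \<subseteq> S" by auto
    then show "B \<in> U" using U c(2) unfolding ultrafilters_on_def by blast
  qed
  then show ?thesis using c unfolding principal_on_def by blast
qed

lemma comp_map_eq:
  assumes "C \<in> graph_comps V E Y" "D \<in> graph_comps V E X" "C \<subseteq> D"
  shows "comp_map V E Y X C = D"
  unfolding comp_map_def
  using assms comp_nonempty[OF assms(1)] comp_unique[of _ V E X D] by (intro the_equality) blast+

lemma uf_limit_ultrafilter:
  "v \<in> uf_limit V E \<Longrightarrow> X \<in> finite_vertex_sets V \<Longrightarrow> v X \<in> ultrafilters_on (graph_comps V E X)"
  unfolding uf_limit_def by (auto simp: PiE_def Pi_def)

text \<open>The compatibility condition, freed of the definite description in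
  \<open>comp_map\<close> and turned into an equivalence, so that membership can be moved both up to
  \<open>Y\<close> and down to \<open>X\<close>.\<close>

lemma uf_limit_refine:
  assumes v: "v \<in> uf_limit V E" and X: "X \<in> finite_vertex_sets V" and Y: "Y \<in> finite_vertex_sets V"
    and "X \<subseteq> Y" and A: "A \<subseteq> graph_comps V E X"
  shows "A \<in> v X \<longleftrightarrow> {C \<in> graph_comps V E Y. \<exists>D\<in>A. C \<subseteq> D} \<in> v Y"
proof -
  have eq: "v X = uf_map V E Y X (v Y)" using v X Y \<open>X \<subseteq> Y\<close> unfolding uf_limit_def by blast
  note U = uf_limit_ultrafilter[OF v Y]
  show ?thesis
  proof
    assume "A \<in> v X"
    then obtain B where B: "B \<in> v Y" "comp_map V E Y X ` B \<subseteq> A" unfolding eq uf_map_def by blast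
    have "C \<in> graph_comps V E Y \<and> (\<exists>D\<in>A. C \<subseteq> D)" if "C \<in> B" for C
    proof -
      have C: "C \<in> graph_comps V E Y" using ultrafilter_sub[OF U B(1)] that by blast
      obtain D where "D \<in> graph_comps V E X" "C \<subseteq> D" using comp_antimono[OF \<open>X \<subseteq> Y\<close> C] .
      then show ?thesis using comp_map_eq[OF C, of D X] B(2) that C by blast
    qed
    then show "{C \<in> graph_comps V E Y. \<exists>D\<in>A. C \<subseteq> D} \<in> v Y"
      by (intro ultrafilter_superset[OF U B(1)]) blast+
  next
    assume "{C \<in> graph_comps V E Y. \<exists>D\<in>A. C \<subseteq> D} \<in> v Y"
    moreover have "comp_map V E Y X ` {C \<in> graph_comps V E Y. \<exists>D\<in>A. C \<subseteq> D} \<subseteq> A"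
    proof (rule image_subsetI)
      fix C assume "C \<in> {C \<in> graph_comps V E Y. \<exists>D\<in>A. C \<subseteq> D}"
      then obtain D where "C \<in> graph_comps V E Y" "D \<in> A" "C \<subseteq> D" by blast
      then show "comp_map V E Y X C \<in> A" using comp_map_eq[of C V E Y D X] A by auto
    qed
    ultimately show "A \<in> v X" using A unfolding eq uf_map_def by blast
  qed
qed

section \<open>Non-principal ultrafilters and critical sets\<close>

text \<open>Each point of \<open>Y\<close> lies in at most one member of
  \<open>\<D>\<close>.\<close>

lemma finite_disjoint_meeting:
  assumes "finite Y" and "\<And>C D. C \<in> \<D> \<Longrightarrow> D \<in> \<D> \<Longrightarrow> C \<inter> D \<noteq> {} \<Longrightarrow> C = D"
  shows "finite {D \<in> \<D>. D \<inter> Y \<noteq> {}}"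
proof -
  have "finite {D \<in> \<D>. y \<in> D}" for y
  proof (cases "\<exists>C\<in>\<D>. y \<in> C")
    case True
    then obtain C where "C \<in> \<D>" "y \<in> C" by blast
    then have "{D \<in> \<D>. y \<in> D} \<subseteq> {C}" using assms(2)[of _ C] by blast
    then show ?thesis by (rule finite_subset) simp
  next
    case False
    then have "{D \<in> \<D>. y \<in> D} = {}" by blast
    then show ?thesis by (metis finite.emptyI)
  qed
  moreover have "{D \<in> \<D>. D \<inter> Y \<noteq> {}} = (\<Union>y\<in>Y. {D \<in> \<D>. y \<in> D})" by blast
  ultimately show ?thesis using assms(1) by simp
qed

lemma finite_comps_meeting: "finite Y \<Longrightarrow> finite {D \<in> graph_comps V E X. D \<inter> Y \<noteq> {}}"
  by (rule finite_disjoint_meeting) (auto dest: comp_unique)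

text \<open>If \<open>x \<in> X - Y\<close>, then almost all components of \<open>G - X\<close> with neighbourhood \<open>X\<close> avoid \<open>Y\<close> and
  are joined by \<open>x\<close> into one component of \<open>G - Y\<close>, which therefore generates \<open>v Y\<close>.\<close>

lemma full_comps_below_nonprincipal:
  assumes v: "v \<in> uf_limit V E"
    and X: "X \<in> finite_vertex_sets V" and npX: "\<not> principal_on (graph_comps V E X) (v X)"
    and full: "{C \<in> graph_comps V E X. neighbourhood V E C = X} \<in> v X"
    and Y: "Y \<in> finite_vertex_sets V" and npY: "\<not> principal_on (graph_comps V E Y) (v Y)"
  shows "X \<subseteq> Y"
proof
  fix x assume x: "x \<in> X"
  let ?Z = "X \<union> Y" and ?K = "{C \<in> graph_comps V E X. neighbourhood V E C = X}"
  let ?B = "{C \<in> graph_comps V E X. C \<inter> Y \<noteq> {}}"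
  note UX = uf_limit_ultrafilter[OF v X] and UY = uf_limit_ultrafilter[OF v Y]
  have Z: "?Z \<in> finite_vertex_sets V" using X Y by (auto simp: finite_vertex_sets_def)
  note UZ = uf_limit_ultrafilter[OF v Z]
  show "x \<in> Y"
  proof (rule ccontr)
    assume xY: "x \<notin> Y"
    have "finite Y" "x \<in> V" using Y X x by (auto simp: finite_vertex_sets_def)
    obtain P where P: "P \<in> graph_comps V E Y" "x \<in> P" using comp_of_vertex[OF \<open>x \<in> V\<close> xY] .
    have "?B \<notin> v X"
      using ultrafilter_finite_principal[OF UX finite_comps_meeting[OF \<open>finite Y\<close>]] npX by blast
    then have "graph_comps V E X - ?B \<in> v X" by (intro ultrafilter_compl[OF UX]) auto
    then have KB: "?K \<inter> (graph_comps V E X - ?B) \<in> v X" by (intro ultrafilter_Int[OF UX full])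
    then have "{C \<in> graph_comps V E ?Z. \<exists>D\<in>?K \<inter> (graph_comps V E X - ?B). C \<subseteq> D} \<in> v ?Z"
      using uf_limit_refine[OF v X Z, of "?K \<inter> (graph_comps V E X - ?B)"] by blast
    moreover have "C \<subseteq> P" if D: "D \<in> ?K \<inter> (graph_comps V E X - ?B)" "C \<subseteq> D" for C D
    proof -
      have conn: "connected_set V E D" using D comp_connected by blast
      obtain y where "y \<in> D" "{y, x} \<in> E" using D x unfolding neighbourhood_def by blast
      then have "connected_set V E (D \<union> {x})"
        using connected_Un_edge[OF conn connected_singleton[OF \<open>x \<in> V\<close>]] by blast
      then have "D \<union> {x} \<subseteq> P" by (rule comp_absorb[OF P(1)]) (use D xY P in auto)
      then show ?thesis using D by blast
    qed
    ultimately have "{C \<in> graph_comps V E ?Z. \<exists>D\<in>{P}. C \<subseteq> D} \<in> v ?Z"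
      by (elim ultrafilter_superset[OF UZ]) auto
    then have "{P} \<in> v Y" using uf_limit_refine[OF v Y Z, of "{P}"] P by blast
    then show False using ultrafilter_finite_principal[OF UY] npY by blast
  qed
qed

text \<open>All neighbourhoods of components left by \<open>Y\<close> are subsets of the finite set
  \<open>Y\<close>, so the components with some common neighbourhood \<open>S\<close> form a member
  of \<open>v Y\<close>. They are also components left by \<open>S\<close>, and \<open>S\<close>
  turns out to be the least non-principal set.\<close>

lemma least_nonprincipal_full:
  assumes G: "simple_graph V E" and v: "v \<in> uf_tangles V E"
  defines "X \<equiv> least_nonprincipal V E v"
  shows "X \<in> finite_vertex_sets V" "\<not> principal_on (graph_comps V E X) (v X)"
    "{C \<in> graph_comps V E X. neighbourhood V E C = X} \<in> v X"
proof -
  obtain Y where Y: "Y \<in> finite_vertex_sets V" and np: "\<not> principal_on (graph_comps V E Y) (v Y)"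
    using v unfolding uf_tangles_def by blast
  have vl: "v \<in> uf_limit V E" using v by (simp add: uf_tangles_def)
  note UY = uf_limit_ultrafilter[OF vl Y]
  have "(\<Union>S\<in>Pow Y. {C \<in> graph_comps V E Y. neighbourhood V E C = S}) = graph_comps V E Y"
    using comp_neighbourhood_subset[OF G] by blast
  then have "\<exists>S\<in>Pow Y. {C \<in> graph_comps V E Y. neighbourhood V E C = S} \<in> v Y"
    using Y ultrafilter_nonempty[OF UY]
    by (intro ultrafilter_finite_UN[OF UY]) (auto simp: finite_vertex_sets_def)
  then obtain S where S: "S \<subseteq> Y" "{C \<in> graph_comps V E Y. neighbourhood V E C = S} \<in> v Y"
    (is "?K \<in> _") by blast
  have Sf: "S \<in> finite_vertex_sets V"
    using S Y by (auto simp: finite_vertex_sets_def intro: finite_subset)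
  have K: "C \<in> graph_comps V E S" if "C \<in> ?K" for C
    using connected_neighbourhood_comp[OF G, of C S] comp_connected[of C V E Y]
      comp_subset[of C V E Y] that S by blast
  let ?F = "{C \<in> graph_comps V E S. neighbourhood V E C = S}"
  have "{C \<in> graph_comps V E Y. \<exists>D\<in>?F. C \<subseteq> D} \<in> v Y"
    by (rule ultrafilter_superset[OF UY S(2)]) (use K in auto)
  then have full: "?F \<in> v S" using uf_limit_refine[OF vl Sf Y S(1), of ?F] by blast
  \<comment> \<open>A generator \<open>D\<close> of \<open>v S\<close> would contain
    \<open>v Y\<close>-almost all components of the class \<open>?K\<close>. Being components left
    by \<open>S\<close> themselves, these equal \<open>D\<close>, so \<open>v Y\<close> would
    contain a finite set.\<close>
  have npS: "\<not> principal_on (graph_comps V E S) (v S)"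
  proof
    assume "principal_on (graph_comps V E S) (v S)"
    then obtain D where D: "D \<in> graph_comps V E S" "{D} \<in> v S" unfolding principal_on_def by auto
    then have "{C \<in> graph_comps V E Y. \<exists>D\<in>{D}. C \<subseteq> D} \<in> v Y"
      using uf_limit_refine[OF vl Sf Y S(1), of "{D}"] by blast
    then have "{C \<in> graph_comps V E Y. \<exists>D\<in>{D}. C \<subseteq> D} \<inter> ?K \<in> v Y"
      using ultrafilter_Int[OF UY] S(2) by blast
    moreover have "{C \<in> graph_comps V E Y. \<exists>D\<in>{D}. C \<subseteq> D} \<inter> ?K \<subseteq> {D}"
    proof
      fix C assume C: "C \<in> {C \<in> graph_comps V E Y. \<exists>D\<in>{D}. C \<subseteq> D} \<inter> ?K"
      then have "C \<in> graph_comps V E S" using K by blast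
      moreover have "C \<inter> D \<noteq> {}" using C comp_nonempty[of C V E Y] by blast
      ultimately show "C \<in> {D}" using comp_unique[of C V E S D] D(1) by simp
    qed
    ultimately show False
      using ultrafilter_finite_principal[OF UY] np finite_subset[of _ "{D}"] by auto
  qed
  have "X = S" unfolding X_def least_nonprincipal_def
  proof (rule Least_equality)
    show "S \<subseteq> Z" if "Z \<in> finite_vertex_sets V \<and> \<not> principal_on (graph_comps V E Z) (v Z)" for Z
      using full_comps_below_nonprincipal[OF vl Sf npS full] that by blast
  qed (use Sf npS in blast)
  with Sf npS full show "X \<in> finite_vertex_sets V" "\<not> principal_on (graph_comps V E X) (v X)"
    "{C \<in> graph_comps V E X. neighbourhood V E C = X} \<in> v X" by simp_all
qed

lemma critical_least_nonprincipal:
  assumes "simple_graph V E" "v \<in> uf_tangles V E"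
  shows "critical V E (least_nonprincipal V E v)"
proof -
  note L = least_nonprincipal_full[OF assms]
  have "v \<in> uf_limit V E" using assms(2) by (simp add: uf_tangles_def)
  from uf_limit_ultrafilter[OF this L(1)] show ?thesis
    using L ultrafilter_finite_principal unfolding critical_def by blast
qed

section \<open>The topology of the tangle compactification\<close>

lemma openin_vertex_star:
  assumes "w \<in> V" "\<And>e. e \<in> E \<Longrightarrow> w \<in> e \<Longrightarrow> 0 < j e \<and> j e < 1"
  shows "openin (tangle_topology V E) (vertex_star E w j)"
proof -
  have "openin (complex_topology V E) (vertex_star E w j)"
    unfolding complex_topology_def
    by (rule topology_generated_by_Basis) (use assms in blast)
  then show ?thesis
    unfolding tangle_topology_def by (intro topology_generated_by_Basis) blast
qed

lemma openin_basic_tangle_set: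
  assumes "X \<in> finite_vertex_sets V" "A \<subseteq> graph_comps V E X"
  shows "openin (tangle_topology V E) (basic_tangle_set V E X A)"
  unfolding tangle_topology_def by (rule topology_generated_by_Basis) (use assms in blast)

lemma Vertex_basic_tangle_set [simp]: "Vertex w \<in> basic_tangle_set V E X A \<longleftrightarrow> w \<in> \<Union>A"
  by (auto simp: basic_tangle_set_def comps_complex_def between_points_def inner_points_def)

lemma Tangle_basic_tangle_set [simp]:
  "Tangle v \<in> basic_tangle_set V E X A \<longleftrightarrow> v \<in> uf_limit V E \<and> A \<in> v X"
  by (auto simp: basic_tangle_set_def comps_complex_def between_points_def inner_points_def)

lemma Inner_basic_tangle_set [simp]:
  "Inner e s \<in> basic_tangle_set V E X A \<longleftrightarrow> 0 < s \<and> s < 1 \<and> e \<in> E \<and>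
     ((\<exists>C\<in>A. e \<subseteq> C) \<or> (\<exists>x\<in>X. \<exists>y\<in>\<Union>A. e = {x, y}))"
proof -
  have *: "Inner e s \<in> \<Union>{inner_points d |d. d \<in> E \<and> P d} \<longleftrightarrow> 0 < s \<and> s < 1 \<and> e \<in> E \<and> P e" for P
    unfolding inner_points_def by blast
  show ?thesis
    unfolding basic_tangle_set_def comps_complex_def between_points_def Un_iff * by auto
qed

text \<open>Distinct components are disjoint and avoid \<open>X\<close>, which takes care of
  vertices and edge points; for tangles, \<open>v X\<close> cannot contain two disjoint
  sets.\<close>

lemma disjnt_basic_tangle_sets:
  assumes G: "simple_graph V E" and X: "X \<in> finite_vertex_sets V"
    and A: "A \<subseteq> graph_comps V E X" and B: "B \<subseteq> graph_comps V E X" and "A \<inter> B = {}"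
  shows "disjnt (basic_tangle_set V E X A) (basic_tangle_set V E X B)"
  unfolding disjnt_iff
proof (intro allI notI)
  fix z assume z: "z \<in> basic_tangle_set V E X A \<and> z \<in> basic_tangle_set V E X B"
  have d: "\<not> (y \<in> C \<and> y \<in> D)" if "C \<in> A" "D \<in> B" for y C D
    using comp_unique[of C V E X D] that assms by blast
  have x: "y \<notin> X" if "C \<in> A \<union> B" "y \<in> C" for y C
    using comp_subset[of C V E X] that A B by blast
  show False
  proof (cases z)
    case (Vertex w)
    then show ?thesis using z d by auto
  next
    case (Inner e s)
    then have "e \<in> E" using z by auto
    then have "e \<noteq> {}" using G by (auto simp: simple_graph_def)
    \<comment> \<open>One description for both kinds of edges, those inside a component and those
      between a component and \<open>X\<close>.\<close>
    have t: "\<exists>C\<in>D. e \<subseteq> X \<union> C \<and> e \<inter> C \<noteq> {}" if "z \<in> basic_tangle_set V E X D" for D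
    proof -
      have "(\<exists>C\<in>D. e \<subseteq> C) \<or> (\<exists>x\<in>X. \<exists>y\<in>\<Union>D. e = {x, y})"
        using that unfolding Inner by simp
      then show ?thesis
      proof
        assume "\<exists>C\<in>D. e \<subseteq> C"
        then show ?thesis using \<open>e \<noteq> {}\<close> by (metis Int_absorb2 le_supI2)
      next
        assume "\<exists>x\<in>X. \<exists>y\<in>\<Union>D. e = {x, y}"
        then obtain x y C where "x \<in> X" "C \<in> D" "y \<in> C" "e = {x, y}" by blast
        then show ?thesis by (intro bexI[of _ C]) auto
      qed
    qed
    obtain C D where "C \<in> A" "e \<subseteq> X \<union> C" "e \<inter> C \<noteq> {}" "D \<in> B" "e \<subseteq> X \<union> D"
      using t[of A] t[of B] z by metis
    then show ?thesis using d[of C D] x[of C] by blast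
  next
    case (Tangle v)
    then have v: "v \<in> uf_limit V E" "A \<in> v X" "B \<in> v X" using z by auto
    show ?thesis
      using ultrafilter_Int[OF uf_limit_ultrafilter[OF v(1) X] v(2,3)] assms(5)
        ultrafilter_empty[OF uf_limit_ultrafilter[OF v(1) X]] by simp
  qed
qed

text \<open>Otherwise the basic open sets of \<open>B\<close> and of its complement in
  \<open>graph_comps V E X\<close> would separate \<open>u\<close> from \<open>v\<close>.\<close>

lemma not_separated_mem_comps:
  assumes G: "simple_graph V E" and "u \<in> V" and v: "v \<in> uf_limit V E"
    and nd: "\<not> have_disjoint_open_nbhds (tangle_topology V E) (Vertex u) (Tangle v)"
    and X: "X \<in> finite_vertex_sets V" and "u \<notin> X" and B: "B \<in> v X"
  shows "u \<in> \<Union>B"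
proof (rule ccontr)
  assume u: "u \<notin> \<Union>B"
  have Bs: "B \<subseteq> graph_comps V E X" using ultrafilter_sub[OF uf_limit_ultrafilter[OF v X] B] .
  have "Vertex u \<in> basic_tangle_set V E X (graph_comps V E X - B)"
    using Union_comps[of V E X] u assms by auto
  moreover have "Tangle v \<in> basic_tangle_set V E X B" using v B by simp
  moreover have "disjnt (basic_tangle_set V E X (graph_comps V E X - B)) (basic_tangle_set V E X B)"
    by (rule disjnt_basic_tangle_sets[OF G X]) (use Bs in auto)
  moreover have "openin (tangle_topology V E) (basic_tangle_set V E X (graph_comps V E X - B))"
    "openin (tangle_topology V E) (basic_tangle_set V E X B)"
    by (rule openin_basic_tangle_set[OF X]; use Bs in auto)+
  ultimately show False using nd unfolding have_disjoint_open_nbhds_def by metis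
qed

text \<open>As \<open>u\<close> lies in \<open>X\<close>, a star at \<open>u\<close> and the basic
  set of \<open>B\<close> can meet only in inner points of edges from \<open>u\<close> to members of
  \<open>B\<close>.\<close>

lemma not_separated_adjacent:
  assumes G: "simple_graph V E" and v: "v \<in> uf_limit V E"
    and nd: "\<not> have_disjoint_open_nbhds (tangle_topology V E) (Vertex u) (Tangle v)"
    and X: "X \<in> finite_vertex_sets V" and u: "u \<in> X" and B: "B \<in> v X"
  obtains y where "y \<in> \<Union>B" "{u, y} \<in> E"
proof -
  have Bs: "B \<subseteq> graph_comps V E X" using ultrafilter_sub[OF uf_limit_ultrafilter[OF v X] B] .
  have uB: "u \<notin> \<Union>B" using u Bs comp_subset[of _ V E X] by blast
  \<comment> \<open>The radius is arbitrary, since a basic set contains either all inner points of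
    an edge or none.\<close>
  let ?S = "vertex_star E u (\<lambda>_. 1/2)"
  have "u \<in> V" using X u by (auto simp: finite_vertex_sets_def)
  then have "openin (tangle_topology V E) ?S" by (intro openin_vertex_star) auto
  moreover have "openin (tangle_topology V E) (basic_tangle_set V E X B)"
    by (rule openin_basic_tangle_set[OF X Bs])
  moreover have "Tangle v \<in> basic_tangle_set V E X B" using v B by simp
  moreover have "Vertex u \<in> ?S" by (simp add: vertex_star_def)
  ultimately have "\<not> disjnt ?S (basic_tangle_set V E X B)"
    using nd unfolding have_disjoint_open_nbhds_def by blast
  then obtain z where z: "z \<in> ?S" "z \<in> basic_tangle_set V E X B" unfolding disjnt_iff by blast
  from z(1) consider "z = Vertex u" | e s where "z = Inner e s" "u \<in> e"
    unfolding vertex_star_def by blast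
  then show thesis
  proof cases
    case 1
    then show ?thesis using z uB by simp
  next
    case (2 e s)
    then have "e \<in> E" "\<exists>y\<in>\<Union>B. e = {u, y}" using z uB by auto
    then show ?thesis using that by blast
  qed
qed

section \<open>Tangles from independent paths\<close>

text \<open>The family of images of \<open>U\<close> under the maps that send a connected set
  avoiding \<open>X\<close> to the component around it. Each map is defined for
  \<open>U\<close>-almost all sets because every finite \<open>X\<close> is eventually
  avoided.\<close>

lemma ultrafilter_uf_limit:
  assumes bot: "U \<noteq> bot" and ultra: "\<And>P. eventually P U \<or> eventually (\<lambda>x. \<not> P x) U"
    and conn: "eventually (connected_set V E) U"
    and avoid: "\<And>X. finite X \<Longrightarrow> eventually (\<lambda>D. D \<inter> X = {}) U"
  shows "(\<lambda>X\<in>finite_vertex_sets V. {A. A \<subseteq> graph_comps V E X \<and> eventually (\<lambda>D. \<exists>C\<in>A. D \<subseteq> C) U})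
    \<in> uf_limit V E"
proof -
  define w where
    "w X = {A. A \<subseteq> graph_comps V E X \<and> eventually (\<lambda>D. \<exists>C\<in>A. D \<subseteq> C) U}" for X
  have cover: "eventually (\<lambda>D. \<exists>C\<in>graph_comps V E X. D \<subseteq> C) U" if "finite X" for X
    using conn avoid[OF that]
  proof eventually_elim
    case (elim D)
    then show ?case using comp_exists[of V E D X] by blast
  qed
  have uf: "w X \<in> ultrafilters_on (graph_comps V E X)" if "finite X" for X
    unfolding ultrafilters_on_def
  proof (intro CollectI conjI ballI allI impI)
    show "w X \<subseteq> Pow (graph_comps V E X)" unfolding w_def by blast
    show "graph_comps V E X \<in> w X" unfolding w_def using cover[OF that] by blast
    show "{} \<notin> w X" unfolding w_def using bot by (simp add: trivial_limit_def)
  next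
    fix A B assume "A \<in> w X" "A \<subseteq> B \<and> B \<subseteq> graph_comps V E X"
    then have "eventually (\<lambda>D. \<exists>C\<in>A. D \<subseteq> C) U" "A \<subseteq> B" "B \<subseteq> graph_comps V E X"
      unfolding w_def by auto
    moreover from this have "eventually (\<lambda>D. \<exists>C\<in>B. D \<subseteq> C) U" by (elim eventually_mono) blast
    ultimately show "B \<in> w X" unfolding w_def by blast
  next
    fix A B assume AB: "A \<in> w X" "B \<in> w X"
    then have "eventually (\<lambda>D. \<exists>C\<in>A. D \<subseteq> C) U" "eventually (\<lambda>D. \<exists>C\<in>B. D \<subseteq> C) U"
      unfolding w_def by auto
    \<comment> \<open>A nonempty set lies in at most one component, so the witnesses for
      \<open>A\<close> and for \<open>B\<close> coincide.\<close>
    then have "eventually (\<lambda>D. \<exists>C\<in>A \<inter> B. D \<subseteq> C) U" using conn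
    proof eventually_elim
      case (elim D)
      then obtain C C' where C: "C \<in> A" "C' \<in> B" "D \<subseteq> C" "D \<subseteq> C'" by blast
      have "D \<noteq> {}" using elim unfolding connected_set_def by blast
      then have "C = C'" using comp_unique[of C V E X C'] C AB unfolding w_def by blast
      then show ?case using C by blast
    qed
    then show "A \<inter> B \<in> w X" using AB unfolding w_def by blast
  next
    fix A assume A: "A \<subseteq> graph_comps V E X"
    show "A \<in> w X \<or> graph_comps V E X - A \<in> w X"
    proof (cases "A \<in> w X")
      case False
      then have "eventually (\<lambda>D. \<not> (\<exists>C\<in>A. D \<subseteq> C)) U"
        using ultra[of "\<lambda>D. \<exists>C\<in>A. D \<subseteq> C"] A unfolding w_def by blast
      then have "eventually (\<lambda>D. \<exists>C\<in>graph_comps V E X - A. D \<subseteq> C) U"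
        using cover[OF that] by eventually_elim blast
      then show ?thesis unfolding w_def by blast
    qed simp
  qed
  have compat: "uf_map V E Y X (w Y) = w X" if "finite X" "finite Y" "X \<subseteq> Y" for X Y
  proof (intro equalityI subsetI)
    fix A assume "A \<in> uf_map V E Y X (w Y)"
    then obtain B where A: "A \<subseteq> graph_comps V E X" and B: "B \<subseteq> graph_comps V E Y"
      "eventually (\<lambda>D. \<exists>C\<in>B. D \<subseteq> C) U" "comp_map V E Y X ` B \<subseteq> A"
      unfolding uf_map_def w_def by blast
    have "\<exists>D\<in>A. C \<subseteq> D" if C: "C \<in> B" for C
    proof -
      have C': "C \<in> graph_comps V E Y" using C B by blast
      obtain D where "D \<in> graph_comps V E X" "C \<subseteq> D" using comp_antimono[OF \<open>X \<subseteq> Y\<close> C'] .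
      then show ?thesis using comp_map_eq[OF C', of D X] C B(3) by blast
    qed
    then have "eventually (\<lambda>D. \<exists>C\<in>A. D \<subseteq> C) U"
      using B(2) by (elim eventually_mono) (meson order_trans)
    then show "A \<in> w X" using A unfolding w_def by blast
  next
    fix A assume "A \<in> w X"
    then have A: "A \<subseteq> graph_comps V E X" "eventually (\<lambda>D. \<exists>C\<in>A. D \<subseteq> C) U"
      unfolding w_def by auto
    let ?B = "{C \<in> graph_comps V E Y. \<exists>D\<in>A. C \<subseteq> D}"
    \<comment> \<open>The component around \<open>D\<close> left by \<open>Y\<close> avoids
      \<open>X\<close> and meets the one left by \<open>X\<close>, hence is contained in it.\<close>
    have "eventually (\<lambda>D. \<exists>C\<in>?B. D \<subseteq> C) U" using A(2) cover[OF \<open>finite Y\<close>] conn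
    proof eventually_elim
      case (elim D)
      then obtain C C' where C: "C \<in> A" "D \<subseteq> C" "C' \<in> graph_comps V E Y" "D \<subseteq> C'" by blast
      have "D \<noteq> {}" using elim unfolding connected_set_def by blast
      then have "C' \<subseteq> C"
        using comp_absorb[of C V E X C'] comp_connected[OF C(3)] comp_subset[OF C(3)] C A(1) that(3)
        by blast
      then show ?case using C by blast
    qed
    then have "?B \<in> w Y" unfolding w_def by blast
    moreover have "comp_map V E Y X ` ?B \<subseteq> A"
    proof (rule image_subsetI)
      fix C assume "C \<in> ?B"
      then obtain D where "C \<in> graph_comps V E Y" "D \<in> A" "C \<subseteq> D" by blast
      then show "comp_map V E Y X C \<in> A" using comp_map_eq[of C V E Y D X] A by auto
    qed
    ultimately show "A \<in> uf_map V E Y X (w Y)" using A(1) unfolding uf_map_def by blast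
  qed
  have "restrict w (finite_vertex_sets V) \<in> uf_limit V E"
    unfolding uf_limit_def using uf compat by (auto simp: finite_vertex_sets_def)
  then show ?thesis unfolding w_def .
qed

text \<open>The conclusion is stable under finite intersections, so it needs to be checked only on the
  generating sets of the topology.\<close>

lemma Tangle_nbhd_contains_edges:
  assumes G: "simple_graph V E"
    and v: "\<And>X A. X \<in> finite_vertex_sets V \<Longrightarrow> A \<in> v X \<Longrightarrow>
      A \<subseteq> graph_comps V E X \<and> eventually (\<lambda>D. \<exists>C\<in>A. D \<subseteq> C) U"
    and "openin (tangle_topology V E) B" "Tangle v \<in> B"
  shows "eventually (\<lambda>D. \<forall>y\<in>D. {u, y} \<in> E \<longrightarrow> inner_points {u, y} \<subseteq> B) U"
  using openin_topology_generated_by[OF assms(3)[unfolded tangle_topology_def]] assms(4)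
proof (induction rule: generate_topology_on.induct)
  case (Int a b)
  then have "eventually (\<lambda>D. \<forall>y\<in>D. {u, y} \<in> E \<longrightarrow> inner_points {u, y} \<subseteq> a) U"
    "eventually (\<lambda>D. \<forall>y\<in>D. {u, y} \<in> E \<longrightarrow> inner_points {u, y} \<subseteq> b) U" by auto
  then show ?case by eventually_elim blast
next
  case (UN K)
  then obtain k where k: "k \<in> K" "Tangle v \<in> k" by blast
  then have "eventually (\<lambda>D. \<forall>y\<in>D. {u, y} \<in> E \<longrightarrow> inner_points {u, y} \<subseteq> k) U"
    using UN by blast
  then show ?case using k by (elim eventually_mono) blast
next
  case (Basis s)
  \<comment> \<open>Open sets of the 1-complex contain no points of the form
    \<open>Tangle v\<close>, so the generating set must be a basic tangle set.\<close>
  have "\<not> openin (complex_topology V E) s"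
  proof
    assume "openin (complex_topology V E) s"
    from openin_subset[OF this] Basis(2) show False
      unfolding complex_topology_def by (auto simp: vertex_star_def)
  qed
  then obtain X A where s: "s = basic_tangle_set V E X A" "X \<in> finite_vertex_sets V" using Basis by blast
  then have "A \<in> v X" using Basis(2) by simp
  note A = v[OF s(2) this]
  from A have "eventually (\<lambda>D. \<exists>C\<in>A. D \<subseteq> C) U" by blast
  then show ?case
  proof eventually_elim
    case (elim D)
    then obtain C where C: "C \<in> A" "D \<subseteq> C" by blast
    show ?case
    proof (intro ballI impI subsetI)
      fix y z assume y: "y \<in> D" "{u, y} \<in> E" "z \<in> inner_points {u, y}"
      \<comment> \<open>An edge from \<open>u\<close> to the component \<open>C\<close> either
        starts in \<open>X\<close> or lies entirely in \<open>C\<close>.\<close>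
      have "(\<exists>C\<in>A. {u, y} \<subseteq> C) \<or> (\<exists>x\<in>X. \<exists>y'\<in>\<Union>A. {u, y} = {x, y'})"
      proof (cases "u \<in> X")
        case True
        then show ?thesis using C y by blast
      next
        case False
        then have "u \<in> C"
          using comp_edge[OF G, of C X y u] A C y by (auto simp: insert_commute)
        then show ?thesis using C y by blast
      qed
      moreover obtain r where "z = Inner {u, y} r" "0 < r" "r < 1"
        using y unfolding inner_points_def by blast
      ultimately show "z \<in> s" using y(2) unfolding s(1) by (simp only: Inner_basic_tangle_set simp_thms)
    qed
  qed
qed simp

text \<open>The generators of the topology include all open sets of another generated topology, so
  the closure argument is isolated in \<open>step\<close> and applied to both layers. Intersections
  are handled by the pointwise minimum of the radii.\<close>

lemma Vertex_nbhd_contains_star: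
  assumes G: "simple_graph V E" and "openin (tangle_topology V E) B" "Vertex w \<in> B"
  shows "\<exists>j. (\<forall>e\<in>E. w \<in> e \<longrightarrow> 0 < j e \<and> j e < 1) \<and> vertex_star E w j \<subseteq> B"
proof -
  define Q where
    "Q B \<longleftrightarrow> (\<exists>j. (\<forall>e\<in>E. w \<in> e \<longrightarrow> 0 < j e \<and> j e < 1) \<and> vertex_star E w j \<subseteq> B)" for B
  have step: "Q B" if "openin (topology_generated_by \<S>) B" "Vertex w \<in> B"
    and Q: "\<And>B. B \<in> \<S> \<Longrightarrow> Vertex w \<in> B \<Longrightarrow> Q B" for \<S> B
    using openin_topology_generated_by[OF that(1)] that(2)
  proof (induction rule: generate_topology_on.induct)
    case (Int a b)
    then obtain i j where i: "\<forall>e\<in>E. w \<in> e \<longrightarrow> 0 < i e \<and> i e < 1" "vertex_star E w i \<subseteq> a"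
      and j: "\<forall>e\<in>E. w \<in> e \<longrightarrow> 0 < j e \<and> j e < 1" "vertex_star E w j \<subseteq> b"
      unfolding Q_def by blast
    have "vertex_star E w (\<lambda>e. min (i e) (j e)) \<subseteq> vertex_star E w i \<inter> vertex_star E w j"
      unfolding vertex_star_def by auto
    then show ?case unfolding Q_def using i j
      by (intro exI[of _ "\<lambda>e. min (i e) (j e)"]) auto
  next
    case (UN K)
    then obtain k where "k \<in> K" "Q k" by blast
    then show ?case unfolding Q_def by blast
  qed (use Q in auto)
  have complex: "Q B" if "openin (complex_topology V E) B" "Vertex w \<in> B" for B
    using that(1) unfolding complex_topology_def
  proof (rule step)
    fix B' assume B': "B' \<in> {{Inner e s |s. a < s \<and> s < b} |e a b. e \<in> E \<and> 0 \<le> a \<and> a < b \<and> b \<le> 1} \<union>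
      {vertex_star E w j |w j. w \<in> V \<and> (\<forall>e\<in>E. w \<in> e \<longrightarrow> 0 < j e \<and> j e < 1)}" "Vertex w \<in> B'"
    then obtain w' j where w': "B' = vertex_star E w' j" "\<forall>e\<in>E. w' \<in> e \<longrightarrow> 0 < j e \<and> j e < 1"
      by auto
    then have "w' = w" using B'(2) unfolding vertex_star_def by auto
    then show "Q B'" using w' unfolding Q_def by blast
  qed (rule that(2))
  have "Q B"
    using assms(2) unfolding tangle_topology_def
  proof (rule step)
    fix B' assume B': "B' \<in> {A. openin (complex_topology V E) A} \<union>
      {basic_tangle_set V E X \<C> |X \<C>. X \<in> finite_vertex_sets V \<and> \<C> \<subseteq> graph_comps V E X}"
      "Vertex w \<in> B'"
    show "Q B'"
    proof (cases "openin (complex_topology V E) B'")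
      case True
      then show ?thesis using complex B' by blast
    next
      case False
      then obtain X A where X: "B' = basic_tangle_set V E X A" "A \<subseteq> graph_comps V E X"
        using B' by blast
      then obtain C where C: "C \<in> A" "w \<in> C" using B' by auto
      \<comment> \<open>The other end of an edge at \<open>w\<close> lies in \<open>X\<close> or in
        the component of \<open>w\<close>. The basic set thus contains all inner points of the edge,
        and any radii will do.\<close>
      have "(\<exists>C\<in>A. e \<subseteq> C) \<or> (\<exists>x\<in>X. \<exists>y\<in>\<Union>A. e = {x, y})" if e: "e \<in> E" "w \<in> e" for e
      proof -
        have "card e = 2" using G e unfolding simple_graph_def by blast
        then obtain y where y: "e = {w, y}" using e(2) by (auto simp: card_2_iff)
        show ?thesis
        proof (cases "y \<in> X")
          case True
          then show ?thesis using C y by (blast intro: insert_commute)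
        next
          case False
          then have "y \<in> C" using comp_edge[OF G, of C X w y] C X e y by blast
          then show ?thesis using C y by blast
        qed
      qed
      then have "vertex_star E w (\<lambda>_. 1/2) \<subseteq> B'"
        using C unfolding vertex_star_def X(1) by auto
      then show ?thesis unfolding Q_def by (intro exI[of _ "\<lambda>_. 1/2"]) auto
    qed
  qed (rule assms(3))
  then show ?thesis unfolding Q_def .
qed

text \<open>A free ultrafilter on \<open>\<D>\<close> induces \<open>v\<close>. A neighbourhood of
  \<open>v\<close> contains all inner points of the edges from \<open>w\<close> to almost every
  member of \<open>\<D>\<close>, a neighbourhood of \<open>w\<close> contains an initial segment of
  each of these edges, and so the two meet.\<close>

lemma disjoint_connectors_imp_not_separated:
  assumes G: "simple_graph V E" and inf: "infinite \<D>"
    and disj: "\<And>C D. C \<in> \<D> \<Longrightarrow> D \<in> \<D> \<Longrightarrow> C \<inter> D \<noteq> {} \<Longrightarrow> C = D"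
    and conn: "\<And>D. D \<in> \<D> \<Longrightarrow> connected_set V E D"
    and adj: "\<And>D w. D \<in> \<D> \<Longrightarrow> w \<in> W \<Longrightarrow> \<exists>y\<in>D. {w, y} \<in> E"
  shows "\<exists>v\<in>uf_limit V E. \<forall>w\<in>W.
    \<not> have_disjoint_open_nbhds (tangle_topology V E) (Vertex w) (Tangle v)"
proof -
  have "inf cofinite (principal \<D>) \<noteq> bot"
    using inf by (simp add: trivial_limit_def eventually_inf_principal eventually_cofinite)
  then obtain U where U: "U \<noteq> bot" "U \<le> inf cofinite (principal \<D>)"
    "\<And>P. eventually P U \<or> eventually (\<lambda>x. \<not> P x) U" using exists_ultrafilter_le by metis
  have ev: "eventually P U" if "finite {D \<in> \<D>. \<not> P D}" for P
    using filter_leD[OF U(2), of P] that by (simp add: eventually_inf_principal eventually_cofinite)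
  define v where "v = (\<lambda>X\<in>finite_vertex_sets V.
    {A. A \<subseteq> graph_comps V E X \<and> eventually (\<lambda>D. \<exists>C\<in>A. D \<subseteq> C) U})"
  have fin0: "finite {D \<in> \<D>. \<not> connected_set V E D}" "finite {D \<in> \<D>. D \<notin> \<D>}"
    using conn by (auto intro: finite_subset[of _ "{}"])
  have "v \<in> uf_limit V E" unfolding v_def
  proof (rule ultrafilter_uf_limit[OF U(1,3)])
    show "eventually (connected_set V E) U" by (rule ev[OF fin0(1)])
    show "eventually (\<lambda>D. D \<inter> X = {}) U" if "finite X" for X
      by (rule ev[OF finite_disjoint_meeting[OF that disj]])
  qed
  moreover have "\<not> have_disjoint_open_nbhds (tangle_topology V E) (Vertex w) (Tangle v)"
    if w: "w \<in> W" for w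
  proof
    assume "have_disjoint_open_nbhds (tangle_topology V E) (Vertex w) (Tangle v)"
    then obtain A B where A: "openin (tangle_topology V E) A" "Vertex w \<in> A"
      and B: "openin (tangle_topology V E) B" "Tangle v \<in> B" and "disjnt A B"
      unfolding have_disjoint_open_nbhds_def by blast
    obtain j where j: "\<forall>e\<in>E. w \<in> e \<longrightarrow> 0 < j e \<and> j e < 1" "vertex_star E w j \<subseteq> A"
      using Vertex_nbhd_contains_star[OF G A] by blast
    have "eventually (\<lambda>D. \<forall>y\<in>D. {w, y} \<in> E \<longrightarrow> inner_points {w, y} \<subseteq> B) U"
      by (rule Tangle_nbhd_contains_edges[OF G _ B]) (simp add: v_def)
    moreover have "eventually (\<lambda>D. D \<in> \<D>) U" by (rule ev[OF fin0(2)])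
    ultimately have "eventually (\<lambda>D. D \<in> \<D> \<and> (\<forall>y\<in>D. {w, y} \<in> E \<longrightarrow> inner_points {w, y} \<subseteq> B)) U"
      by eventually_elim blast
    then obtain D where D: "D \<in> \<D>" "\<forall>y\<in>D. {w, y} \<in> E \<longrightarrow> inner_points {w, y} \<subseteq> B"
      using eventually_happens'[OF U(1)] by blast
    then obtain y where y: "y \<in> D" "{w, y} \<in> E" using adj w by blast
    define e where "e = {w, y}"
    \<comment> \<open>The point at distance \<open>j e / 2\<close> from \<open>w\<close>; its
      parameter depends on which end of \<open>e\<close> is \<open>edge_tail e\<close>.\<close>
    define s where "s = (if w = edge_tail e then j e / 2 else 1 - j e / 2)"
    have e: "e \<in> E" "w \<in> e" "inner_points e \<subseteq> B" using y D unfolding e_def by auto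
    then have je: "0 < j e" "j e < 1" using j by auto
    have "Inner e s \<in> vertex_star E w j" using e je
      unfolding vertex_star_def s_def dist_from_def by auto
    moreover have "Inner e s \<in> inner_points e" using je unfolding inner_points_def s_def by auto
    ultimately show False using j(2) e(3) \<open>disjnt A B\<close> unfolding disjnt_iff by blast
  qed
  ultimately show ?thesis by blast
qed

lemma AB_path_decomp:
  assumes "AB_path V E {u} {t} p" "u \<noteq> t"
  obtains q where "p = u # q @ [t]" "inner_vertices p = set q"
proof -
  have p: "p \<noteq> []" "hd p = u" "last p = t" "distinct p"
    using assms unfolding AB_path_def is_path_def by auto
  define q where "q = butlast (tl p)"
  have "p = u # tl p" using p by (metis list.collapse)
  moreover have "tl p \<noteq> []" using p assms(2) calculation by (metis last_ConsL)
  ultimately have eq: "p = u # q @ [t]"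
    unfolding q_def using p by (metis append_butlast_last_id last_ConsR)
  have "inner_vertices p = set q" using p(4) unfolding inner_vertices_def eq by auto
  then show ?thesis using that eq by blast
qed

lemma independent_paths_imp_not_separated:
  assumes G: "simple_graph V E" and ut: "u \<noteq> t" and inf: "infinite P"
    and P: "\<And>p. p \<in> P \<Longrightarrow> AB_path V E {u} {t} p" and ind: "independent_paths P"
  shows "\<exists>v\<in>uf_limit V E. \<forall>w\<in>{u, t}.
    \<not> have_disjoint_open_nbhds (tangle_topology V E) (Vertex w) (Tangle v)"
proof -
  \<comment> \<open>The path consisting of a single edge is discarded because its interior is
    empty.\<close>
  define P' where "P' = P - {[u, t]}"
  have P': "connected_set V E (inner_vertices p) \<and> (\<exists>y\<in>inner_vertices p. {u, y} \<in> E) \<and>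
    (\<exists>y\<in>inner_vertices p. {t, y} \<in> E)" if p: "p \<in> P'" for p
  proof -
    have ab: "AB_path V E {u} {t} p" using P p P'_def by blast
    obtain q where q: "p = u # q @ [t]" "inner_vertices p = set q" using AB_path_decomp[OF ab ut] .
    have ne: "q \<noteq> []" using q p unfolding P'_def by auto
    have "is_path V E p" using ab unfolding AB_path_def by blast
    then have *: "is_path V E q" "{u, hd q} \<in> E" "{last q, t} \<in> E"
      unfolding q(1) is_path_def using ne by (auto simp: successively_Cons successively_append_iff)
    have "{t, last q} \<in> E" using *(3) by (simp add: insert_commute)
    then show ?thesis
      using is_path_connected[OF *(1)] *(2) ne hd_in_set last_in_set unfolding q(2) by blast
  qed
  have disj: "p = q" if "p \<in> P'" "q \<in> P'" "inner_vertices p \<inter> inner_vertices q \<noteq> {}" for p q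
  proof -
    have "inner_vertices q \<subseteq> set q" unfolding inner_vertices_def by blast
    then show ?thesis using ind that unfolding independent_paths_def P'_def by blast
  qed
  \<comment> \<open>Disjoint nonempty interiors are distinct, so infinitely many paths have
    infinitely many interiors.\<close>
  have "inner_vertices p \<noteq> {}" if "p \<in> P'" for p using P'[OF that] by blast
  then have "inj_on inner_vertices P'" using disj by (intro inj_onI) simp
  moreover have "infinite P'" using inf unfolding P'_def by simp
  ultimately have "infinite (inner_vertices ` P')" using finite_imageD by blast
  then show ?thesis
  proof (rule disjoint_connectors_imp_not_separated[OF G])
    show "\<And>D. D \<in> inner_vertices ` P' \<Longrightarrow> connected_set V E D" using P' by blast
    show "C = D" if "C \<in> inner_vertices ` P'" "D \<in> inner_vertices ` P'" "C \<inter> D \<noteq> {}" for C D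
      using that disj by blast
    show "\<exists>y\<in>D. {w, y} \<in> E" if "D \<in> inner_vertices ` P'" "w \<in> {u, t}" for D w
      using that P' by blast
  qed
qed

section \<open>Dominated ends\<close>

lemma connected_ray_segment:
  assumes "r \<in> rays V E" "m \<le> n"
  shows "connected_set V E (r ` {m..n})"
  using assms(2)
proof (induction n rule: dec_induct)
  case base
  then show ?case using assms(1) connected_singleton[of "r m" V E] by (auto simp: rays_def)
next
  case (step n)
  have "connected_set V E (r ` {m..n} \<union> {r (Suc n)})"
    by (rule connected_Un_edge[OF step.IH connected_singleton, of _ "r n"])
      (use assms(1) step in \<open>auto simp: rays_def\<close>)
  then show ?case using step(1) by (simp add: atLeastAtMostSuc_conv)
qed

lemma ray_tail_avoids:
  assumes "r \<in> rays V E" "finite S"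
  obtains m where "\<And>k. k \<ge> m \<Longrightarrow> r k \<notin> S"
proof -
  have "finite (r -` S)" using assms by (auto simp: rays_def intro: finite_vimageI)
  then obtain m where "\<forall>k\<in>r -` S. k < m" using finite_nat_set_iff_bounded by blast
  then show ?thesis using that[of m] by (meson not_le vimageI2)
qed

text \<open>A vertex of \<open>r\<close> far enough out lies on both rays and outside any given
  finite set. Since domination concerns all rays of an end, one may thus pass to a tail that misses
  the dominating vertex.\<close>

lemma ray_equiv_tail:
  assumes r: "r \<in> rays V E"
  shows "(\<lambda>n. r (m + n)) \<in> ray_equiv V E `` {r}"
proof -
  have r': "(\<lambda>n. r (m + n)) \<in> rays V E" using r by (auto simp: rays_def intro!: injI dest: injD)
  have "\<not> separates V E S (range r) (range (\<lambda>n. r (m + n)))" if "finite S" for S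
  proof -
    obtain k where "\<And>i. i \<ge> k \<Longrightarrow> r i \<notin> S" using ray_tail_avoids[OF r \<open>finite S\<close>] by blast
    then have "r (m + k) \<notin> S" by simp
    moreover have "connected_set V E {r (m + k)}"
      using r by (intro connected_singleton) (auto simp: rays_def)
    ultimately show ?thesis
      unfolding not_separates_iff by (intro exI[of _ "{r (m + k)}"]) auto
  qed
  then show ?thesis using r r' unfolding ray_equiv_def finite_vertex_sets_def by blast
qed

text \<open>A path from \<open>w\<close> to a tail without \<open>w\<close> is nontrivial, so
  deleting \<open>w\<close> from it leaves a connected set containing a neighbour of
  \<open>w\<close>.\<close>

lemma dominatesD:
  assumes r: "r \<in> rays V E" and dom: "dominates V E w (ray_equiv V E `` {r})" and "finite S"
  shows "\<exists>D. connected_set V E D \<and> D \<inter> S = {} \<and> D \<inter> range r \<noteq> {} \<and> (\<exists>y\<in>D. {w, y} \<in> E)"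
proof -
  obtain m where m: "\<And>k. k \<ge> m \<Longrightarrow> r k \<notin> {w}" using ray_tail_avoids[OF r, of "{w}"] by blast
  \<comment> \<open>Domination only speaks of finite subsets of \<open>V - {w}\<close>, whereas
    \<open>S\<close> is arbitrary; the path without \<open>w\<close> nevertheless avoids all of
    \<open>S\<close>.\<close>
  let ?r = "\<lambda>n. r (m + n)" and ?S = "(S - {w}) \<inter> V"
  have "?S \<in> finite_vertex_sets (V - {w})" using \<open>finite S\<close> by (auto simp: finite_vertex_sets_def)
  then have "\<not> separates V E ?S {w} (range ?r)"
    using dom ray_equiv_tail[OF r, of m] unfolding dominates_def by blast
  then obtain p where p: "AB_path V E {w} (range ?r) p" "set p \<inter> ?S = {}"
    unfolding separates_def by blast
  have path: "is_path V E p" "hd p = w" "last p \<in> range ?r" using p unfolding AB_path_def by auto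
  then obtain q where q: "p = w # q" unfolding is_path_def by (metis list.collapse)
  have "?r n \<noteq> w" for n using m[of "m + n"] by simp
  then have "w \<notin> range ?r" by blast
  then have "q \<noteq> []" using path(3) q by auto
  then have *: "is_path V E q" "{w, hd q} \<in> E" "w \<notin> set q"
    using path(1) unfolding q is_path_def by (auto simp: successively_Cons)
  have "last q \<in> range r" using path(3) q \<open>q \<noteq> []\<close> by auto
  moreover have "set q \<inter> S = {}" using p(2) * unfolding q is_path_def by auto
  ultimately show ?thesis using is_path_connected[OF *(1)] *(2) \<open>q \<noteq> []\<close> hd_in_set last_in_set
    by (intro exI[of _ "set q"]) blast
qed

text \<open>Both sets avoid the first \<open>m\<close> vertices of the ray, so they meet it only
  further out, where the segment between two meeting points avoids \<open>S\<close>.\<close>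

lemma connected_join_ray:
  assumes r: "r \<in> rays V E" and m: "\<And>k. k \<ge> m \<Longrightarrow> r k \<notin> S"
    and A: "connected_set V E A" "A \<inter> (S \<union> r ` {..<m}) = {}" "A \<inter> range r \<noteq> {}"
    and B: "connected_set V E B" "B \<inter> (S \<union> r ` {..<m}) = {}" "B \<inter> range r \<noteq> {}"
  obtains D where "connected_set V E D" "D \<inter> S = {}" "A \<subseteq> D" "B \<subseteq> D"
proof -
  obtain a b where ab: "r a \<in> A" "r b \<in> B" using A B by blast
  have ge: "a \<ge> m" "b \<ge> m" using ab A(2) B(2) by (meson UnCI disjoint_iff imageI lessThan_iff not_le)+
  let ?R = "r ` {min a b..max a b}"
  have R: "connected_set V E ?R" by (rule connected_ray_segment[OF r]) simp
  have mem: "r a \<in> ?R" "r b \<in> ?R" by auto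
  have "connected_set V E (A \<union> ?R)" by (rule connected_Un[OF A(1) R]) (use ab mem in blast)
  then have "connected_set V E (A \<union> ?R \<union> B)"
    by (rule connected_Un[OF _ B(1)]) (use ab mem in blast)
  moreover have "?R \<inter> S = {}" using m ge by fastforce
  ultimately show ?thesis using that[of "A \<union> ?R \<union> B"] A(2) B(2) by blast
qed

text \<open>Connections to the single ray \<open>r\<close> suffice: a segment of \<open>r\<close>
  links them to a connected set that joins \<open>r\<close> to any other ray \<open>s\<close> of the
  end.\<close>

lemma dominatesI:
  assumes r: "r \<in> rays V E" and w: "w \<in> V"
    and fan: "\<And>S. finite S \<Longrightarrow>
      \<exists>D. connected_set V E D \<and> D \<inter> S = {} \<and> D \<inter> range r \<noteq> {} \<and> (\<exists>y\<in>D. {w, y} \<in> E)"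
  shows "dominates V E w (ray_equiv V E `` {r})"
  unfolding dominates_def
proof (intro notI, elim bexE)
  fix S s assume S: "S \<in> finite_vertex_sets (V - {w})" and s: "s \<in> ray_equiv V E `` {r}"
    and sep: "separates V E S {w} (range s)"
  have "finite S" "S \<subseteq> V" "w \<notin> S" using S by (auto simp: finite_vertex_sets_def)
  obtain m where m: "\<And>k. k \<ge> m \<Longrightarrow> r k \<notin> S" using ray_tail_avoids[OF r \<open>finite S\<close>] by blast
  let ?S = "S \<union> r ` {..<m}"
  have "?S \<in> finite_vertex_sets V"
    using r \<open>finite S\<close> \<open>S \<subseteq> V\<close> by (auto simp: finite_vertex_sets_def rays_def)
  then have "\<not> separates V E ?S (range r) (range s)" using s unfolding ray_equiv_def by blast
  then obtain B where B: "connected_set V E B" "B \<inter> ?S = {}" "B \<inter> range r \<noteq> {}" "B \<inter> range s \<noteq> {}"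
    unfolding not_separates_iff by blast
  have "finite ?S" using \<open>finite S\<close> by simp
  from fan[OF this] obtain A y where A: "connected_set V E A" "A \<inter> ?S = {}" "A \<inter> range r \<noteq> {}"
    and y: "y \<in> A" "{w, y} \<in> E" by blast
  obtain D where D: "connected_set V E D" "D \<inter> S = {}" "A \<subseteq> D" "B \<subseteq> D"
    using connected_join_ray[OF r m A B(1-3)] by blast
  have "connected_set V E ({w} \<union> D)"
    by (rule connected_Un_edge[OF connected_singleton[OF w] D(1), of w y]) (use y D in auto)
  moreover have "({w} \<union> D) \<inter> S = {}" "({w} \<union> D) \<inter> {w} \<noteq> {}" "({w} \<union> D) \<inter> range s \<noteq> {}"
    using D B(4) \<open>w \<notin> S\<close> by auto
  ultimately have "\<not> separates V E S {w} (range s)" unfolding not_separates_iff by blast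
  then show False using sep by blast
qed

section \<open>Greedy construction of independent paths\<close>

text \<open>The common consequence of a dominated end and of a critical set. As \<open>S\<close> may
  contain \<open>u\<close> and \<open>t\<close>, the set \<open>D\<close> can be made to avoid
  them.\<close>

definition infinitely_joined :: "'a set \<Rightarrow> 'a set set \<Rightarrow> 'a \<Rightarrow> 'a \<Rightarrow> bool" where
  "infinitely_joined V E u t \<longleftrightarrow> (\<forall>S. finite S \<longrightarrow>
     (\<exists>D. connected_set V E D \<and> D \<inter> S = {} \<and> (\<exists>y\<in>D. {u, y} \<in> E) \<and> (\<exists>y\<in>D. {t, y} \<in> E)))"

text \<open>Connected sets reaching the ray from neighbours of \<open>u\<close> and of
  \<open>t\<close> are linked by a segment of the ray outside \<open>S\<close>.\<close>

lemma dominated_end_imp_infinitely_joined: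
  assumes "\<omega> \<in> graph_ends V E" "dominates V E u \<omega>" "dominates V E t \<omega>"
  shows "infinitely_joined V E u t"
  unfolding infinitely_joined_def
proof (intro allI impI)
  fix S :: "'a set" assume "finite S"
  obtain r where r: "r \<in> rays V E" and \<omega>: "\<omega> = ray_equiv V E `` {r}"
    using assms(1) unfolding graph_ends_def by (auto elim: quotientE)
  obtain m where m: "\<And>k. k \<ge> m \<Longrightarrow> r k \<notin> S" using ray_tail_avoids[OF r \<open>finite S\<close>] by blast
  let ?S = "S \<union> r ` {..<m}"
  have "finite ?S" using \<open>finite S\<close> by simp
  from dominatesD[OF r assms(2)[unfolded \<omega>] this] obtain A y where
    A: "connected_set V E A" "A \<inter> ?S = {}" "A \<inter> range r \<noteq> {}" and y: "y \<in> A" "{u, y} \<in> E" by blast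
  from dominatesD[OF r assms(3)[unfolded \<omega>] \<open>finite ?S\<close>] obtain B z where
    B: "connected_set V E B" "B \<inter> ?S = {}" "B \<inter> range r \<noteq> {}" and z: "z \<in> B" "{t, z} \<in> E" by blast
  obtain D where "connected_set V E D" "D \<inter> S = {}" "A \<subseteq> D" "B \<subseteq> D"
    using connected_join_ray[OF r m A B] by blast
  then show "\<exists>D. connected_set V E D \<and> D \<inter> S = {} \<and> (\<exists>y\<in>D. {u, y} \<in> E) \<and> (\<exists>y\<in>D. {t, y} \<in> E)"
    using y z by blast
qed

text \<open>Only finitely many components meet \<open>S\<close>, so one of those with neighbourhood
  \<open>X\<close> avoids it and serves as \<open>D\<close>.\<close>

lemma critical_imp_infinitely_joined:
  assumes "critical V E X" "u \<in> X" "t \<in> X"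
  shows "infinitely_joined V E u t"
  unfolding infinitely_joined_def
proof (intro allI impI)
  fix S :: "'a set" assume "finite S"
  let ?K = "{C \<in> graph_comps V E X. neighbourhood V E C = X}"
  have "infinite ?K" using assms(1) unfolding critical_def by blast
  then have "infinite (?K - {C \<in> graph_comps V E X. C \<inter> S \<noteq> {}})"
    using finite_comps_meeting[OF \<open>finite S\<close>] by (simp add: Diff_infinite_finite)
  then have "?K - {C \<in> graph_comps V E X. C \<inter> S \<noteq> {}} \<noteq> {}" by (rule infinite_imp_nonempty)
  then obtain C where C: "C \<in> graph_comps V E X" "neighbourhood V E C = X" "C \<inter> S = {}" by blast
  have "\<exists>y\<in>C. {w, y} \<in> E" if "w \<in> X" for w
  proof -
    have "w \<in> neighbourhood V E C" using C(2) that by simp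
    then show ?thesis unfolding neighbourhood_def by (auto simp: insert_commute)
  qed
  then show "\<exists>D. connected_set V E D \<and> D \<inter> S = {} \<and> (\<exists>y\<in>D. {u, y} \<in> E) \<and> (\<exists>y\<in>D. {t, y} \<in> E)"
    using comp_connected[OF C(1)] C(3) assms(2,3) by (intro exI[of _ C]) simp
qed

lemma infinitely_joined_imp_independent_paths:
  assumes uV: "u \<in> V" and tV: "t \<in> V" and ut: "u \<noteq> t" and join: "infinitely_joined V E u t"
  shows "\<exists>P. infinite P \<and> (\<forall>p\<in>P. AB_path V E {u} {t} p) \<and> independent_paths P"
proof -
  \<comment> \<open>Empty interiors are excluded so that disjoint interiors belong to different
    paths.\<close>
  define good where "good q \<longleftrightarrow> q \<noteq> [] \<and> AB_path V E {u} {t} (u # q @ [t])" for q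
  have ex: "\<exists>q. good q \<and> set q \<inter> S = {}" if "finite S" for S
  proof -
    have "finite (S \<union> {u, t})" using that by simp
    then obtain D y z where D: "connected_set V E D" "D \<inter> (S \<union> {u, t}) = {}"
      and y: "y \<in> D" "{u, y} \<in> E" and z: "z \<in> D" "{t, z} \<in> E"
      using join unfolding infinitely_joined_def by metis
    obtain q where q: "is_path V E q" "set q \<subseteq> D" "hd q = y" "last q = z"
      using connected_set_path[OF D(1) y(1) z(1)] .
    have "{z, t} \<in> E" using z(2) by (simp add: insert_commute)
    moreover have "u \<notin> set q" "t \<notin> set q" "set q \<inter> S = {}" using D q(2) by auto
    ultimately have "is_path V E (u # q @ [t])"
      using q y uV tV ut unfolding is_path_def
      by (auto simp: successively_Cons successively_append_iff)
    then have "good q"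
      using q(1) \<open>u \<notin> set q\<close> \<open>t \<notin> set q\<close> ut unfolding good_def AB_path_def is_path_def by auto
    then show ?thesis using \<open>set q \<inter> S = {}\<close> by blast
  qed
  \<comment> \<open>\<open>snd (f n)\<close> is the interior chosen at stage \<open>n\<close>, and
    the finite set \<open>fst (f n)\<close> contains all interiors chosen up to then.\<close>
  have "\<exists>f. \<forall>n. (finite (fst (f n)) \<and> good (snd (f n)) \<and> set (snd (f n)) \<subseteq> fst (f n)) \<and>
    (fst (f n) \<subseteq> fst (f (Suc n)) \<and> set (snd (f (Suc n))) \<inter> fst (f n) = {})"
  proof (rule dependent_nat_choice)
    obtain q where "good q" using ex[of "{}"] by blast
    then show "\<exists>x. finite (fst x) \<and> good (snd x) \<and> set (snd x) \<subseteq> fst x"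
      by (intro exI[of _ "(set q, q)"]) simp
  next
    fix x :: "'a set \<times> 'a list" and n :: nat
    assume x: "finite (fst x) \<and> good (snd x) \<and> set (snd x) \<subseteq> fst x"
    then obtain q where "good q" "set q \<inter> fst x = {}" using ex by blast
    then show "\<exists>y. (finite (fst y) \<and> good (snd y) \<and> set (snd y) \<subseteq> fst y) \<and>
      (fst x \<subseteq> fst y \<and> set (snd y) \<inter> fst x = {})"
      using x by (intro exI[of _ "(fst x \<union> set q, q)"]) auto
  qed
  then obtain f where f: "\<And>n. good (snd (f n))" "\<And>n. set (snd (f n)) \<subseteq> fst (f n)"
    "\<And>n. fst (f n) \<subseteq> fst (f (Suc n))" "\<And>n. set (snd (f (Suc n))) \<inter> fst (f n) = {}" by blast
  define q where "q n = snd (f n)" for n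
  have disj: "set (q m) \<inter> set (q n) = {}" if mn: "m < n" for m n
  proof -
    obtain k where k: "n = Suc k" "m \<le> k" using less_imp_Suc_add[OF mn] by auto
    have "set (q m) \<subseteq> fst (f k)"
      using lift_Suc_mono_le[of "\<lambda>n. fst (f n)", OF f(3) k(2)] f(2)[of m] unfolding q_def by blast
    then show ?thesis using f(4)[of k] unfolding q_def k(1) by blast
  qed
  have disj': "set (q m) \<inter> set (q n) = {}" if "m \<noteq> n" for m n
    using disj[of m n] disj[of n m] that by (cases "m < n") auto
  have ne: "q n \<noteq> []" and path: "AB_path V E {u} {t} (u # q n @ [t])" for n
    using f(1)[of n] unfolding good_def q_def by auto
  have nin: "u \<notin> set (q n)" "t \<notin> set (q n)" for n
    using path[of n] unfolding AB_path_def is_path_def by auto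
  let ?p = "\<lambda>n. u # q n @ [t]"
  have "inj ?p"
  proof (rule injI)
    fix m n assume "?p m = ?p n"
    then have "q m = q n" by simp
    then show "m = n" using disj'[of m n] ne[of n] by (cases "m = n") auto
  qed
  then have "infinite (range ?p)" by (rule range_inj_infinite)
  moreover have "independent_paths (range ?p)"
    unfolding independent_paths_def
  proof (intro ballI impI)
    fix p p' assume "p \<in> range ?p" "p' \<in> range ?p" "p \<noteq> p'"
    then obtain m n where mn: "p = ?p m" "p' = ?p n" "m \<noteq> n" by blast
    then show "inner_vertices p \<inter> set p' = {}"
      using disj'[of m n] nin[of m] unfolding inner_vertices_def by auto
  qed
  ultimately show ?thesis using path by blast
qed

section \<open>Ends from directions\<close>

text \<open>The map \<open>C\<close> is a direction, a consistent choice of components. The ray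
  meets infinitely many disjoint finite connected blocks, each with neighbours of both vertices; a
  finite set misses one of them, and this block is what \<open>dominatesI\<close> asks for.\<close>

lemma dominated_end_of_direction:
  assumes G: "simple_graph V E" and uV: "u \<in> V" and tV: "t \<in> V"
    and C: "\<And>X. X \<in> finite_vertex_sets V \<Longrightarrow> C X \<in> graph_comps V E X"
    and mono: "\<And>X Y. X \<in> finite_vertex_sets V \<Longrightarrow> Y \<in> finite_vertex_sets V \<Longrightarrow> X \<subseteq> Y \<Longrightarrow> C Y \<subseteq> C X"
    and adj: "\<And>X w. X \<in> finite_vertex_sets V \<Longrightarrow> w \<in> {u, t} \<Longrightarrow> w \<in> X \<Longrightarrow> \<exists>y\<in>C X. {w, y} \<in> E"
  shows "\<exists>\<omega>\<in>graph_ends V E. dominates V E u \<omega> \<and> dominates V E t \<omega>"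
proof -
  define inv where "inv x \<longleftrightarrow> (case x of (X, p) \<Rightarrow> X \<in> finite_vertex_sets V \<and> u \<in> X \<and> t \<in> X \<and>
    is_path V E p \<and> set p \<subseteq> X \<and> (\<exists>y\<in>C X. {last p, y} \<in> E))" for x
  define block where "block F \<longleftrightarrow> connected_set V E F \<and> (\<forall>w\<in>{u, t}. \<exists>y\<in>F. {w, y} \<in> E)" for F
  define succ where "succ x y \<longleftrightarrow> (case (x, y) of ((X, p), (Y, p')) \<Rightarrow> X \<subseteq> Y \<and> block (Y - X) \<and>
    (\<exists>q. q \<noteq> [] \<and> p' = p @ q \<and> set q \<subseteq> Y - X))" for x y
  \<comment> \<open>Stage \<open>n\<close> consists of a finite set \<open>X\<close> of used vertices and an initial path \<open>p\<close> of the ray that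
    can be continued into \<open>C X\<close>; each step adds a whole block to \<open>X\<close>, but only part of it to \<open>p\<close>.\<close>
  have "\<exists>f. \<forall>n. inv (f n) \<and> succ (f n) (f (Suc n))"
  proof (rule dependent_nat_choice)
    have "{u, t} \<in> finite_vertex_sets V" using uV tV by (simp add: finite_vertex_sets_def)
    then show "\<exists>x. inv x"
      using adj[of "{u, t}" u] uV by (intro exI[of _ "({u, t}, [u])"]) (simp add: inv_def is_path_def)
  next
    fix x and n :: nat assume "inv x"
    obtain X p where x: "x = (X, p)" by fastforce
    from \<open>inv x\<close> obtain a where X: "X \<in> finite_vertex_sets V" "u \<in> X" "t \<in> X"
      and p: "is_path V E p" "set p \<subseteq> X" and a: "a \<in> C X" "{last p, a} \<in> E"
      unfolding inv_def x by auto
    note CX = C[OF X(1)]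
    note conn = comp_connected[OF CX]
    obtain y where y: "y \<in> C X" "{u, y} \<in> E" using adj[OF X(1), of u] X by auto
    obtain z where z: "z \<in> C X" "{t, z} \<in> E" using adj[OF X(1), of t] X by auto
    \<comment> \<open>Both paths start at \<open>a\<close>, which is adjacent to the end of
      \<open>p\<close>, so their union is connected and contains neighbours of \<open>u\<close> and
      of \<open>t\<close>.\<close>
    obtain py where py: "is_path V E py" "set py \<subseteq> C X" "hd py = a" "last py = y"
      using connected_set_path[OF conn a(1) y(1)] .
    obtain pz where pz: "is_path V E pz" "set pz \<subseteq> C X" "hd pz = a" "last pz = z"
      using connected_set_path[OF conn a(1) z(1)] .
    let ?F = "set py \<union> set pz"
    have mem: "a \<in> set py" "a \<in> set pz" "y \<in> set py" "z \<in> set pz"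
      using py(1,3,4) pz(1,3,4) hd_in_set[of py] hd_in_set[of pz] last_in_set[of py] last_in_set[of pz]
      unfolding is_path_def by simp_all
    have connF: "connected_set V E ?F"
      by (rule connected_Un[OF is_path_connected[OF py(1)] is_path_connected[OF pz(1)]])
        (use mem in blast)
    have FX: "?F \<inter> X = {}" "?F \<subseteq> C X" using py(2) pz(2) comp_subset[OF CX] by blast+
    define Y where "Y = X \<union> ?F"
    have YX: "Y - X = ?F" using FX(1) unfolding Y_def by blast
    have Y: "Y \<in> finite_vertex_sets V"
      using X(1) comp_subset[OF CX] FX(2) unfolding Y_def finite_vertex_sets_def by auto
    have CY: "C Y \<subseteq> C X" by (rule mono[OF X(1) Y]) (simp add: Y_def)
    \<comment> \<open>If the block \<open>?F\<close> sent no edge to \<open>C Y\<close>, then \<open>C Y\<close> would be a component of \<open>G - X\<close>.\<close>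
    have "\<exists>h\<in>?F. \<exists>g\<in>C Y. {h, g} \<in> E"
    proof (rule ccontr)
      assume neg: "\<not> (\<exists>h\<in>?F. \<exists>g\<in>C Y. {h, g} \<in> E)"
      have "neighbourhood V E (C Y) \<subseteq> Y" by (rule comp_neighbourhood_subset[OF G C[OF Y]])
      then have "neighbourhood V E (C Y) \<subseteq> X"
        using neg unfolding Y_def neighbourhood_def by (auto simp: insert_commute)
      moreover have "C Y \<inter> X = {}" using comp_subset[OF C[OF Y]] unfolding Y_def by blast
      ultimately have "C Y \<in> graph_comps V E X"
        by (rule connected_neighbourhood_comp[OF G comp_connected[OF C[OF Y]]])
      then have "C Y = C X" using comp_maximal[OF _ conn comp_subset[OF CX] CY] by simp
      then show False using a(1) mem comp_subset[OF C[OF Y]] unfolding Y_def by blast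
    qed
    then obtain h g where h: "h \<in> ?F" "g \<in> C Y" "{h, g} \<in> E" by blast
    have "a \<in> ?F" using mem by blast
    \<comment> \<open>Continuing \<open>p\<close> to \<open>h\<close> preserves the invariant, as
      \<open>h\<close> has the neighbour \<open>g\<close> in \<open>C Y\<close>.\<close>
    obtain q where q: "is_path V E q" "set q \<subseteq> ?F" "hd q = a" "last q = h"
      using connected_set_path[OF connF \<open>a \<in> ?F\<close> h(1)] .
    have qne: "q \<noteq> []" using q(1) unfolding is_path_def by blast
    have "set p \<inter> set q = {}" using p(2) q(2) FX(1) by blast
    then have "is_path V E (p @ q)"
      using p(1) q(1,3) a(2) unfolding is_path_def by (simp add: successively_append_iff)
    moreover have "last (p @ q) = h" using q(4) qne by simp
    moreover have "set (p @ q) \<subseteq> Y" using p(2) q(2) unfolding Y_def by auto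
    ultimately have "inv (Y, p @ q)"
      using Y X h unfolding inv_def by (auto simp: Y_def)
    moreover have "block ?F" using connF y z mem unfolding block_def by auto
    then have "succ x (Y, p @ q)"
      using q(2) qne YX unfolding succ_def x by (auto simp: Y_def)
    ultimately show "\<exists>y. inv y \<and> succ x y" by blast
  qed
  then obtain f where f: "\<And>n. inv (f n)" "\<And>n. succ (f n) (f (Suc n))" by blast
  define X p where "X n = fst (f n)" and "p n = snd (f n)" for n
  have path: "is_path V E (p n)" and pX: "set (p n) \<subseteq> X n" for n
    using f(1)[of n] unfolding inv_def X_def p_def by (auto split: prod.splits)
  have Xmono: "X n \<subseteq> X (Suc n)" and block: "block (X (Suc n) - X n)"
    and ext: "\<exists>q. q \<noteq> [] \<and> p (Suc n) = p n @ q \<and> set q \<subseteq> X (Suc n) - X n" for n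
    using f(2)[of n] unfolding succ_def X_def p_def by (auto split: prod.splits)
  have len: "n < length (p n)" for n
  proof (induction n)
    case 0
    then show ?case using path[of 0] by (simp add: is_path_def)
  next
    case (Suc n)
    obtain q where "q \<noteq> []" "p (Suc n) = p n @ q" using ext by blast
    then show ?case using Suc by (cases q) auto
  qed
  have stable: "p m ! k = p n ! k" if "n \<le> m" "k < length (p n)" for m n k
    using that(1)
  proof (induction m rule: dec_induct)
    case (step m)
    have "k < length (p m)" using step(1)
    proof (induction m rule: dec_induct)
      case (step m)
      then show ?case using ext[of m] by auto
    qed (rule that(2))
    then show ?case using ext[of m] step.IH by (auto simp: nth_append)
  qed simp
  \<comment> \<open>The paths \<open>p n\<close> extend one another and have more than
    \<open>n\<close> vertices, so the diagonal is their common limit.\<close>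
  define r where "r n = p n ! n" for n
  have r_nth: "p n ! k = r k" if "k < length (p n)" for n k
    using stable[of n "max n k" k] stable[of k "max n k" k] len[of k] that unfolding r_def by simp
  have ray: "r \<in> rays V E"
    unfolding rays_def
  proof (intro CollectI conjI allI)
    have "r i \<noteq> r j" if "i < j" for i j
    proof -
      have "i < length (p j)" using len[of j] that by simp
      then have "p j ! i \<noteq> p j ! j"
        using path[of j] len[of j] that unfolding is_path_def by (simp add: nth_eq_iff_index_eq)
      then show ?thesis using r_nth[OF \<open>i < length (p j)\<close>] unfolding r_def by simp
    qed
    then show "inj r" by (rule linorder_injI)
    show "range r \<subseteq> V" using path len unfolding is_path_def r_def by (auto dest: nth_mem)
    fix n
    have "successively (\<lambda>x y. {x, y} \<in> E) (p (Suc n))" using path unfolding is_path_def by blast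
    then have "{p (Suc n) ! n, p (Suc n) ! Suc n} \<in> E"
      using len[of "Suc n"] by (simp add: successively_conv_nth)
    then show "{r n, r (Suc n)} \<in> E" using r_nth[of n "Suc n"] len[of "Suc n"] by (simp add: r_def)
  qed
  have fan: "\<exists>D. connected_set V E D \<and> D \<inter> S = {} \<and> D \<inter> range r \<noteq> {} \<and> (\<exists>y\<in>D. {w, y} \<in> E)"
    if w: "w \<in> {u, t}" and S: "finite S" for w S
  proof -
    \<comment> \<open>The blocks are pairwise disjoint; if \<open>S\<close> met all of them,
      choosing a vertex in each would inject the naturals into \<open>S\<close>.\<close>
    have "\<exists>n. (X (Suc n) - X n) \<inter> S = {}"
    proof (rule ccontr)
      assume "\<not> (\<exists>n. (X (Suc n) - X n) \<inter> S = {})"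
      then have "\<forall>n. \<exists>s. s \<in> (X (Suc n) - X n) \<inter> S" by blast
      then obtain g where g: "\<And>n. g n \<in> X (Suc n) - X n" "\<And>n. g n \<in> S" by (metis IntD1 IntD2)
      have "g i \<noteq> g j" if "i < j" for i j
        using lift_Suc_mono_le[of X, OF Xmono, of "Suc i" j] that g(1)[of i] g(1)[of j] by auto
      then have "inj g" by (rule linorder_injI)
      then have "infinite (range g)" by (rule range_inj_infinite)
      moreover have "range g \<subseteq> S" using g(2) by blast
      ultimately show False using S finite_subset by blast
    qed
    then obtain n where n: "(X (Suc n) - X n) \<inter> S = {}" by blast
    \<comment> \<open>The nonempty extension made at this stage puts a vertex of the ray into the
      block.\<close>
    obtain q where q: "q \<noteq> []" "p (Suc n) = p n @ q" "set q \<subseteq> X (Suc n) - X n" using ext by blast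
    have "hd q \<in> set q" "hd q \<in> set (p (Suc n))" using q by auto
    then obtain k where "k < length (p (Suc n))" "p (Suc n) ! k = hd q" by (meson in_set_conv_nth)
    then have "hd q \<in> range r" using r_nth[of k "Suc n"] by (metis rangeI)
    then have "(X (Suc n) - X n) \<inter> range r \<noteq> {}" using q \<open>hd q \<in> set q\<close> by blast
    moreover have "connected_set V E (X (Suc n) - X n)" "\<exists>y\<in>X (Suc n) - X n. {w, y} \<in> E"
      using block[of n] w unfolding block_def by blast+
    ultimately show ?thesis using n by (intro exI[of _ "X (Suc n) - X n"]) simp
  qed
  have "ray_equiv V E `` {r} \<in> graph_ends V E" unfolding graph_ends_def using ray by (rule quotientI)
  moreover have "dominates V E u (ray_equiv V E `` {r})"
    by (rule dominatesI[OF ray uV fan]) simp_all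
  moreover have "dominates V E t (ray_equiv V E `` {r})"
    by (rule dominatesI[OF ray tV fan]) simp_all
  ultimately show ?thesis by blast
qed

section \<open>From inseparable points to ends and tangles, and the cycle of implications\<close>

lemma not_separated_imp_end_or_tangle:
  assumes G: "simple_graph V E" and uV: "u \<in> V" and tV: "t \<in> V" and v: "v \<in> uf_limit V E"
    and ns: "\<And>w. w \<in> {u, t} \<Longrightarrow>
      \<not> have_disjoint_open_nbhds (tangle_topology V E) (Vertex w) (Tangle v)"
  shows "(\<exists>\<omega>\<in>graph_ends V E. dominates V E u \<omega> \<and> dominates V E t \<omega>) \<or>
    (\<exists>v\<in>uf_tangles V E. {u, t} \<subseteq> least_nonprincipal V E v)"
proof (cases "v \<in> uf_tangles V E")
  case True
  let ?X = "least_nonprincipal V E v"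
  note L = least_nonprincipal_full[OF G True]
  note U = uf_limit_ultrafilter[OF v L(1)]
  have "w \<in> ?X" if w: "w \<in> {u, t}" for w
  proof (rule ccontr)
    assume "w \<notin> ?X"
    have "w \<in> V" using w uV tV by blast
    obtain D where D: "D \<in> graph_comps V E ?X" "w \<in> D"
      using comp_of_vertex[OF \<open>w \<in> V\<close> \<open>w \<notin> ?X\<close>] .
    \<comment> \<open>By non-principality the components other than \<open>D\<close> form a member
      of \<open>v ?X\<close>, and inseparability forces \<open>w\<close> into one of them although
      \<open>w\<close> lies in \<open>D\<close>.\<close>
    have "{D} \<notin> v ?X" using ultrafilter_finite_principal[OF U] L(2) by blast
    then have "graph_comps V E ?X - {D} \<in> v ?X" using ultrafilter_compl[OF U, of "{D}"] D by blast
    from not_separated_mem_comps[OF G \<open>w \<in> V\<close> v ns[OF w] L(1) \<open>w \<notin> ?X\<close> this]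
    obtain D' where "D' \<in> graph_comps V E ?X" "D' \<noteq> D" "w \<in> D'" by blast
    then show False using comp_unique[of D' V E ?X D] D by blast
  qed
  then show ?thesis using True by blast
next
  case False
  \<comment> \<open>The generators of the principal ultrafilters form a direction; compatibility of
    the family makes it consistent.\<close>
  then have "\<forall>X\<in>finite_vertex_sets V. \<exists>D\<in>graph_comps V E X. v X = {A. A \<subseteq> graph_comps V E X \<and> D \<in> A}"
    using v unfolding uf_tangles_def principal_on_def by blast
  then obtain C where C: "\<And>X. X \<in> finite_vertex_sets V \<Longrightarrow> C X \<in> graph_comps V E X"
    and vC: "\<And>X. X \<in> finite_vertex_sets V \<Longrightarrow> v X = {A. A \<subseteq> graph_comps V E X \<and> C X \<in> A}"
    by metis
  have single: "{C X} \<in> v X" if "X \<in> finite_vertex_sets V" for X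
    using C[OF that] unfolding vC[OF that] by simp
  have "\<exists>\<omega>\<in>graph_ends V E. dominates V E u \<omega> \<and> dominates V E t \<omega>"
  proof (rule dominated_end_of_direction[OF G uV tV C])
    fix X Y assume X: "X \<in> finite_vertex_sets V" and Y: "Y \<in> finite_vertex_sets V" and "X \<subseteq> Y"
    have "{D \<in> graph_comps V E Y. \<exists>D'\<in>{C X}. D \<subseteq> D'} \<in> v Y"
      using uf_limit_refine[OF v X Y \<open>X \<subseteq> Y\<close>, of "{C X}"] single[OF X] C[OF X] by blast
    then show "C Y \<subseteq> C X" unfolding vC[OF Y] by blast
  next
    fix X w assume X: "X \<in> finite_vertex_sets V" and w: "w \<in> {u, t}" "w \<in> X"
    obtain y where "y \<in> \<Union>{C X}" "{w, y} \<in> E"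
      using not_separated_adjacent[OF G v ns[OF w(1)] X w(2) single[OF X]] .
    then show "\<exists>y\<in>C X. {w, y} \<in> E" by blast
  qed
  then show ?thesis by blast
qed

theorem theorem3p3p5:
  fixes V :: "'a set" and E :: "'a set set" and u t :: 'a
  assumes "simple_graph V E" and "u \<in> V" and "t \<in> V" and "u \<noteq> t"
  defines "cond_i \<equiv>
      (\<exists>P. infinite P \<and> (\<forall>p\<in>P. AB_path V E {u} {t} p) \<and> independent_paths P)"
    and "cond_ii \<equiv>
      (\<exists>v \<in> uf_limit V E.
         \<not> have_disjoint_open_nbhds (tangle_topology V E) (Vertex u) (Tangle v) \<and>
         \<not> have_disjoint_open_nbhds (tangle_topology V E) (Vertex t) (Tangle v))"
    and "cond_iii \<equiv>
      (\<exists>\<omega> \<in> graph_ends V E. dominates V E u \<omega> \<and> dominates V E t \<omega>) \<or>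
      (\<exists>v \<in> uf_tangles V E. {u, t} \<subseteq> least_nonprincipal V E v)"
    and "cond_iv \<equiv>
      (\<exists>\<omega> \<in> graph_ends V E. dominates V E u \<omega> \<and> dominates V E t \<omega>) \<or>
      (\<exists>X. critical V E X \<and> u \<in> X \<and> t \<in> X)"
  shows "(cond_i \<longleftrightarrow> cond_ii) \<and> (cond_ii \<longleftrightarrow> cond_iii) \<and> (cond_iii \<longleftrightarrow> cond_iv)"
proof -
  note G = assms(1) and uV = assms(2) and tV = assms(3) and ut = assms(4)
  have i_ii: cond_ii if cond_i
  proof -
    obtain P where P: "infinite P" "\<And>p. p \<in> P \<Longrightarrow> AB_path V E {u} {t} p" "independent_paths P"
      using \<open>cond_i\<close> unfolding cond_i_def by blast
    show ?thesis
      using independent_paths_imp_not_separated[OF G ut P] unfolding cond_ii_def by simp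
  qed
  have ii_iii: cond_iii if cond_ii
  proof -
    obtain v where v: "v \<in> uf_limit V E"
      "\<not> have_disjoint_open_nbhds (tangle_topology V E) (Vertex u) (Tangle v)"
      "\<not> have_disjoint_open_nbhds (tangle_topology V E) (Vertex t) (Tangle v)"
      using \<open>cond_ii\<close> unfolding cond_ii_def by blast
    show ?thesis unfolding cond_iii_def
      by (rule not_separated_imp_end_or_tangle[OF G uV tV v(1)]) (use v(2,3) in auto)
  qed
  have iii_iv: cond_iv if cond_iii
    using that critical_least_nonprincipal[OF G] unfolding cond_iii_def cond_iv_def by blast
  have iv_i: cond_i if cond_iv
  proof -
    have "infinitely_joined V E u t"
      using that dominated_end_imp_infinitely_joined critical_imp_infinitely_joined
      unfolding cond_iv_def by metis
    then show ?thesis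
      unfolding cond_i_def by (rule infinitely_joined_imp_independent_paths[OF uV tV ut])
  qed
  show ?thesis using i_ii ii_iii iii_iv iv_i by blast
qed

end
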